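(* Let $(\mathcal C,\mathbb E,\mathfrak s)$ be a skeletally small extriangulated category, and let $(T,\epsilon,\eta)$ and $(R,\gamma,\mu)$ be two $\delta$-functors on $\mathcal C$ each of which satisfies the assumptions (i)–(iii) listed in the context. Then there is a unique isomorphism of $\delta$-functors $\theta^i:R^i\rightarrow T^i$, $i\geq 0$, such that $\theta^0=\mathrm{id}_{\mathrm{Hom}_{\mathcal C}(?,-)}$.
   Context: Extriangulated categories are in the sense of Nakaoka–Palu. An $\mathbb E$-extension is an element $\delta\in\mathbb E(C,A)$; a morphism of $\mathbb E$-extensions from $\delta\in\mathbb E(C,A)$ to $\delta'\in\mathbb E(C',A')$ is a pair $(a:A\to A',c:C\to C')$ with $a_*\delta=c^*\delta'$; an $\mathfrak s$-triangle ($\mathbb E$-triangle) $A\xrightarrow{k}B\xrightarrow{p}C\overset{\delta}{\dashrightarrow}$ means that $A\to B\to C$ realizes $\delta$; $p$ is then called a deflation and $k$ an inflation. $\mathcal C$-$\mathcal C$-bimodules are biadditive functors $\mathcal C^{op}\times\mathcal C\to\mathrm{Ab}$, written $T(?,-)$. A right $\mathcal C$-module $G:\mathcal C^{op}\to\mathrm{Ab}$ is weakly effaceable if for each $C$ and each $x\in G(C)$ there is a deflation $p:B\to C$ with $G(p)(x)=0$; dually for left modules with inflations. A bimodule $G$ is weakly effaceable if $G(?,C)$ and $G(C,-)$ are weakly effaceable for all $C$. A $\delta$-functor is a triple $(T,\epsilon,\eta)$ where $T=(T^i)_{i\ge 0}$ is a sequence of $\mathcal C$-$\mathcal C$-bimodules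 and, for each $\delta\in\mathbb E(C,A)$ and $i\ge 0$, $\epsilon^i_\delta:T^i(A,-)\to T^{i+1}(C,-)$ and $\eta^i_\delta:T^i(?,C)\to T^{i+1}(?,A)$ are morphisms natural with respect to morphisms of $\mathbb E$-extensions, such that for each $\mathfrak s$-triangle $A\xrightarrow{k}B\xrightarrow{p}C\overset{\delta}{\dashrightarrow}$ the complexes $$T^0(C,-)\to\cdots\to T^n(C,-)\xrightarrow{T^n(p,-)}T^n(B,-)\xrightarrow{T^n(k,-)}T^n(A,-)\xrightarrow{\epsilon^n_\delta}T^{n+1}(C,-)\to\cdots$$ $$T^0(?,A)\to\cdots\to T^n(?,A)\xrightarrow{T^n(?,k)}T^n(?,B)\xrightarrow{T^n(?,p)}T^n(?,C)\xrightarrow{\eta^n_\delta}T^{n+1}(?,A)\to\cdots$$ are exact (at every term except the initial one). A morphism of $\delta$-functors is a family of bimodule morphisms $\theta^i$ compatible with the connecting morphisms $\epsilon$ and $\eta$. Assumptions on a $\delta$-functor $(T,\epsilon,\eta)$: (i) $T^0=\mathrm{Hom}_{\mathcal C}(?,-)$ and $T^i$ is weakly effaceable for $i>0$. (Then $T^1$ is identified with $\mathbb E$ via the unique isomorphism compatible with $\epsilon$, so that $(\epsilon^0_\delta)_U:\mathrm{Hom}(A,U)\to\mathbb E(C,U)$ is $f\mapsto f_*\delta$.) (ii) Under this identification $T^1\cong\mathbb E$, the map $(\eta^0_\delta)_U:\mathrm{Hom}(U,C)\to\mathbb E(U,A)$ is $f\mapsto f^*\delta$ for all $U\in\mathcal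 C$ and $\delta\in\mathbb E(C,A)$. (iii) For each $i\ge 2$ and any two $\mathfrak s$-triangles $A\to B\to C\overset{\delta}{\dashrightarrow}$ and $F\to G\to H\overset{\psi}{\dashrightarrow}$, one has $\eta^{i-1}_\psi\circ\epsilon^{i-2}_\delta=\epsilon^{i-1}_\delta\circ\eta^{i-2}_\psi$ as maps $T^{i-2}(A,H)\to T^i(C,F)$. *)

theory Defs
  imports "HOL-Algebra.Exact_Sequence"
begin

text \<open>
  Abelian groups are commutative groups of HOL-Algebra, whose notation is multiplicative:
  \<open>x \<otimes>\<^bsub>G\<^esub> y\<close> is the sum \<open>x + y\<close> and \<open>\<one>\<^bsub>G\<^esub>\<close> is the zero element.
  Composition is written in the usual order, so \<open>g \<cdot> f\<close> means \<open>f\<close> first.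
  All functions are relevant only on the objects, arrows and carriers in question; their
  values elsewhere are arbitrary.
\<close>


section \<open>Additive categories\<close>

record ('o, 'm) cat =
  Obj :: "'o set"
  Hom :: "'o \<Rightarrow> 'o \<Rightarrow> 'm monoid"
  Comp :: "'m \<Rightarrow> 'm \<Rightarrow> 'm"  (infixl \<open>\<cdot>\<index>\<close> 70)
  ident :: "'o \<Rightarrow> 'm"

text \<open>
  The objects form a set of elements of some type, so every such category is small, and hence
  skeletally small; no separate hypothesis is needed for this.
\<close>

locale preadditive_category =
  fixes \<C> :: "('o, 'm, 'z) cat_scheme" (structure)
  assumes hom_group: "\<lbrakk>A \<in> Obj \<C>; B \<in> Obj \<C>\<rbrakk> \<Longrightarrow> comm_group (Hom \<C> A B)"
    and hom_disjoint:
      "\<lbrakk>A \<in> Obj \<C>; B \<in> Obj \<C>; A' \<in> Obj \<C>; B' \<in> Obj \<C>;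
        f \<in> carrier (Hom \<C> A B); f \<in> carrier (Hom \<C> A' B')\<rbrakk> \<Longrightarrow> A = A' \<and> B = B'"
    and ident_in_hom: "A \<in> Obj \<C> \<Longrightarrow> ident \<C> A \<in> carrier (Hom \<C> A A)"
    and comp_in_hom:
      "\<lbrakk>A \<in> Obj \<C>; B \<in> Obj \<C>; D \<in> Obj \<C>; f \<in> carrier (Hom \<C> A B); g \<in> carrier (Hom \<C> B D)\<rbrakk>
        \<Longrightarrow> g \<cdot> f \<in> carrier (Hom \<C> A D)"
    and comp_ident_right:
      "\<lbrakk>A \<in> Obj \<C>; B \<in> Obj \<C>; f \<in> carrier (Hom \<C> A B)\<rbrakk> \<Longrightarrow> f \<cdot> ident \<C> A = f"
    and comp_ident_left:
      "\<lbrakk>A \<in> Obj \<C>; B \<in> Obj \<C>; f \<in> carrier (Hom \<C> A B)\<rbrakk> \<Longrightarrow> ident \<C> B \<cdot> f = f"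
    and comp_assoc:
      "\<lbrakk>A \<in> Obj \<C>; B \<in> Obj \<C>; D \<in> Obj \<C>; F \<in> Obj \<C>;
        f \<in> carrier (Hom \<C> A B); g \<in> carrier (Hom \<C> B D); h \<in> carrier (Hom \<C> D F)\<rbrakk>
        \<Longrightarrow> (h \<cdot> g) \<cdot> f = h \<cdot> (g \<cdot> f)"
    and comp_add_right:
      "\<lbrakk>A \<in> Obj \<C>; B \<in> Obj \<C>; D \<in> Obj \<C>;
        f \<in> carrier (Hom \<C> A B); f' \<in> carrier (Hom \<C> A B); g \<in> carrier (Hom \<C> B D)\<rbrakk>
        \<Longrightarrow> g \<cdot> (f \<otimes>\<^bsub>Hom \<C> A B\<^esub> f') = (g \<cdot> f) \<otimes>\<^bsub>Hom \<C> A D\<^esub> (g \<cdot> f')"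
    and comp_add_left:
      "\<lbrakk>A \<in> Obj \<C>; B \<in> Obj \<C>; D \<in> Obj \<C>;
        f \<in> carrier (Hom \<C> A B); g \<in> carrier (Hom \<C> B D); g' \<in> carrier (Hom \<C> B D)\<rbrakk>
        \<Longrightarrow> (g \<otimes>\<^bsub>Hom \<C> B D\<^esub> g') \<cdot> f = (g \<cdot> f) \<otimes>\<^bsub>Hom \<C> A D\<^esub> (g' \<cdot> f)"

definition isomorphism :: "('o, 'm, 'z) cat_scheme \<Rightarrow> 'o \<Rightarrow> 'o \<Rightarrow> 'm \<Rightarrow> bool" where
  "isomorphism \<C> A B f \<longleftrightarrow>
     f \<in> carrier (Hom \<C> A B) \<and>
     (\<exists>g \<in> carrier (Hom \<C> B A). g \<cdot>\<^bsub>\<C>\<^esub> f = ident \<C> A \<and> f \<cdot>\<^bsub>\<C>\<^esub> g = ident \<C> B)"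

definition zero_object :: "('o, 'm, 'z) cat_scheme \<Rightarrow> 'o \<Rightarrow> bool" where
  "zero_object \<C> Z \<longleftrightarrow>
     Z \<in> Obj \<C> \<and>
     (\<forall>A \<in> Obj \<C>. carrier (Hom \<C> A Z) = {\<one>\<^bsub>Hom \<C> A Z\<^esub>} \<and> carrier (Hom \<C> Z A) = {\<one>\<^bsub>Hom \<C> Z A\<^esub>})"

definition biproduct ::
  "('o, 'm, 'z) cat_scheme \<Rightarrow> 'o \<Rightarrow> 'o \<Rightarrow> 'o \<Rightarrow> 'm \<Rightarrow> 'm \<Rightarrow> 'm \<Rightarrow> 'm \<Rightarrow> bool" where
  "biproduct \<C> A\<^sub>1 A\<^sub>2 S i\<^sub>1 i\<^sub>2 p\<^sub>1 p\<^sub>2 \<longleftrightarrow>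
     A\<^sub>1 \<in> Obj \<C> \<and> A\<^sub>2 \<in> Obj \<C> \<and> S \<in> Obj \<C> \<and>
     i\<^sub>1 \<in> carrier (Hom \<C> A\<^sub>1 S) \<and> i\<^sub>2 \<in> carrier (Hom \<C> A\<^sub>2 S) \<and>
     p\<^sub>1 \<in> carrier (Hom \<C> S A\<^sub>1) \<and> p\<^sub>2 \<in> carrier (Hom \<C> S A\<^sub>2) \<and>
     p\<^sub>1 \<cdot>\<^bsub>\<C>\<^esub> i\<^sub>1 = ident \<C> A\<^sub>1 \<and> p\<^sub>2 \<cdot>\<^bsub>\<C>\<^esub> i\<^sub>2 = ident \<C> A\<^sub>2 \<and>
     p\<^sub>2 \<cdot>\<^bsub>\<C>\<^esub> i\<^sub>1 = \<one>\<^bsub>Hom \<C> A\<^sub>1 A\<^sub>2\<^esub> \<and> p\<^sub>1 \<cdot>\<^bsub>\<C>\<^esub> i\<^sub>2 = \<one>\<^bsub>Hom \<C> A\<^sub>2 A\<^sub>1\<^esub> \<and>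
     (i\<^sub>1 \<cdot>\<^bsub>\<C>\<^esub> p\<^sub>1) \<otimes>\<^bsub>Hom \<C> S S\<^esub> (i\<^sub>2 \<cdot>\<^bsub>\<C>\<^esub> p\<^sub>2) = ident \<C> S"

locale additive_category = preadditive_category +
  assumes zero_object_exists: "\<exists>Z. zero_object \<C> Z"
    and biproduct_exists:
      "\<lbrakk>A\<^sub>1 \<in> Obj \<C>; A\<^sub>2 \<in> Obj \<C>\<rbrakk> \<Longrightarrow> \<exists>S i\<^sub>1 i\<^sub>2 p\<^sub>1 p\<^sub>2. biproduct \<C> A\<^sub>1 A\<^sub>2 S i\<^sub>1 i\<^sub>2 p\<^sub>1 p\<^sub>2"


section \<open>Bimodules\<close>

text \<open>
  A bimodule \<open>M\<close> is a biadditive functor, contravariant in its first and covariant in its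
  second argument: \<open>val M X A\<close> is the group \<open>M(X, A)\<close>, and for \<open>f : X' \<rightarrow> X\<close>, \<open>g : A \<rightarrow> A'\<close>
  the map \<open>act M f g\<close> is \<open>M(f, g) : M(X, A) \<rightarrow> M(X', A')\<close>.
\<close>

record ('o, 'm, 'g) bimod =
  val :: "'o \<Rightarrow> 'o \<Rightarrow> 'g monoid"
  act :: "'m \<Rightarrow> 'm \<Rightarrow> 'g \<Rightarrow> 'g"

locale bimodule = preadditive_category \<C> for \<C> :: "('o, 'm, 'z) cat_scheme" (structure) +
  fixes M :: "('o, 'm, 'g) bimod"
  assumes val_group: "\<lbrakk>X \<in> Obj \<C>; A \<in> Obj \<C>\<rbrakk> \<Longrightarrow> comm_group (val M X A)"
    and act_hom:
      "\<lbrakk>X \<in> Obj \<C>; X' \<in> Obj \<C>; A \<in> Obj \<C>; A' \<in> Obj \<C>;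
        f \<in> carrier (Hom \<C> X' X); g \<in> carrier (Hom \<C> A A')\<rbrakk>
        \<Longrightarrow> act M f g \<in> hom (val M X A) (val M X' A')"
    and act_ident:
      "\<lbrakk>X \<in> Obj \<C>; A \<in> Obj \<C>; x \<in> carrier (val M X A)\<rbrakk>
        \<Longrightarrow> act M (ident \<C> X) (ident \<C> A) x = x"
    and act_comp:
      "\<lbrakk>X \<in> Obj \<C>; X' \<in> Obj \<C>; X'' \<in> Obj \<C>; A \<in> Obj \<C>; A' \<in> Obj \<C>; A'' \<in> Obj \<C>;
        f \<in> carrier (Hom \<C> X' X); f' \<in> carrier (Hom \<C> X'' X');
        g \<in> carrier (Hom \<C> A A'); g' \<in> carrier (Hom \<C> A' A''); x \<in> carrier (val M X A)\<rbrakk>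
        \<Longrightarrow> act M (f \<cdot> f') (g' \<cdot> g) x = act M f' g' (act M f g x)"
    and act_add_left:
      "\<lbrakk>X \<in> Obj \<C>; X' \<in> Obj \<C>; A \<in> Obj \<C>; A' \<in> Obj \<C>;
        f \<in> carrier (Hom \<C> X' X); f' \<in> carrier (Hom \<C> X' X); g \<in> carrier (Hom \<C> A A');
        x \<in> carrier (val M X A)\<rbrakk>
        \<Longrightarrow> act M (f \<otimes>\<^bsub>Hom \<C> X' X\<^esub> f') g x = act M f g x \<otimes>\<^bsub>val M X' A'\<^esub> act M f' g x"
    and act_add_right:
      "\<lbrakk>X \<in> Obj \<C>; X' \<in> Obj \<C>; A \<in> Obj \<C>; A' \<in> Obj \<C>;
        f \<in> carrier (Hom \<C> X' X); g \<in> carrier (Hom \<C> A A'); g' \<in> carrier (Hom \<C> A A');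
        x \<in> carrier (val M X A)\<rbrakk>
        \<Longrightarrow> act M f (g \<otimes>\<^bsub>Hom \<C> A A'\<^esub> g') x = act M f g x \<otimes>\<^bsub>val M X' A'\<^esub> act M f g' x"

definition hom_bimodule :: "('o, 'm, 'z) cat_scheme \<Rightarrow> ('o, 'm, 'm) bimod" where
  "hom_bimodule \<C> = \<lparr>val = Hom \<C>, act = (\<lambda>f g h. g \<cdot>\<^bsub>\<C>\<^esub> h \<cdot>\<^bsub>\<C>\<^esub> f)\<rparr>"

definition bimodule_hom ::
  "('o, 'm, 'z) cat_scheme \<Rightarrow> ('o, 'm, 'g) bimod \<Rightarrow> ('o, 'm, 'h) bimod \<Rightarrow>
   ('o \<Rightarrow> 'o \<Rightarrow> 'g \<Rightarrow> 'h) \<Rightarrow> bool" where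
  "bimodule_hom \<C> M N \<theta> \<longleftrightarrow>
     (\<forall>X \<in> Obj \<C>. \<forall>A \<in> Obj \<C>. \<theta> X A \<in> hom (val M X A) (val N X A)) \<and>
     (\<forall>X \<in> Obj \<C>. \<forall>X' \<in> Obj \<C>. \<forall>A \<in> Obj \<C>. \<forall>A' \<in> Obj \<C>.
        \<forall>f \<in> carrier (Hom \<C> X' X). \<forall>g \<in> carrier (Hom \<C> A A'). \<forall>x \<in> carrier (val M X A).
          \<theta> X' A' (act M f g x) = act N f g (\<theta> X A x))"

definition bimodule_iso ::
  "('o, 'm, 'z) cat_scheme \<Rightarrow> ('o, 'm, 'g) bimod \<Rightarrow> ('o, 'm, 'h) bimod \<Rightarrow>
   ('o \<Rightarrow> 'o \<Rightarrow> 'g \<Rightarrow> 'h) \<Rightarrow> bool" where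
  "bimodule_iso \<C> M N \<theta> \<longleftrightarrow>
     bimodule_hom \<C> M N \<theta> \<and>
     (\<forall>X \<in> Obj \<C>. \<forall>A \<in> Obj \<C>. \<theta> X A \<in> iso (val M X A) (val N X A))"


section \<open>Extriangulated categories\<close>

text \<open>
  \<open>Ext \<C>\<close> is the bimodule \<open>\<bbbE>\<close>, and \<open>realization \<C> C A \<delta>\<close> is the equivalence class \<open>\<s>(\<delta>)\<close> for
  \<open>\<delta> \<in> \<bbbE>(C, A)\<close>; a sequence \<open>A \<rightarrow> B \<rightarrow> C\<close> with arrows \<open>k\<close>, \<open>p\<close> is the triple \<open>(B, k, p)\<close>.
\<close>

record ('o, 'm, 'e) extri = "('o, 'm) cat" +
  Ext :: "('o, 'm, 'e) bimod"
  realization :: "'o \<Rightarrow> 'o \<Rightarrow> 'e \<Rightarrow> ('o \<times> 'm \<times> 'm) set"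

definition push :: "('o, 'm, 'e, 'z) extri_scheme \<Rightarrow> 'o \<Rightarrow> 'm \<Rightarrow> 'e \<Rightarrow> 'e" where
  "push \<C> C a \<delta> = act (Ext \<C>) (ident \<C> C) a \<delta>"  \<comment> \<open>\<open>a\<^sub>* \<delta>\<close> for \<open>\<delta> \<in> \<bbbE>(C, A)\<close>, \<open>a : A \<rightarrow> A'\<close>\<close>

definition pull :: "('o, 'm, 'e, 'z) extri_scheme \<Rightarrow> 'o \<Rightarrow> 'm \<Rightarrow> 'e \<Rightarrow> 'e" where
  "pull \<C> A c \<delta> = act (Ext \<C>) c (ident \<C> A) \<delta>"  \<comment> \<open>\<open>c\<^sup>* \<delta>\<close> for \<open>\<delta> \<in> \<bbbE>(C, A)\<close>, \<open>c : C' \<rightarrow> C\<close>\<close>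

text \<open>
  \<open>ext_morphism \<C> C A \<delta> C' A' \<delta>' a c\<close>: the pair \<open>(a, c)\<close> is a morphism of extensions from
  \<open>\<delta> \<in> \<bbbE>(C, A)\<close> to \<open>\<delta>' \<in> \<bbbE>(C', A')\<close>.
\<close>

definition ext_morphism ::
  "('o, 'm, 'e, 'z) extri_scheme \<Rightarrow> 'o \<Rightarrow> 'o \<Rightarrow> 'e \<Rightarrow> 'o \<Rightarrow> 'o \<Rightarrow> 'e \<Rightarrow> 'm \<Rightarrow> 'm \<Rightarrow> bool" where
  "ext_morphism \<C> C A \<delta> C' A' \<delta>' a c \<longleftrightarrow>
     \<delta> \<in> carrier (val (Ext \<C>) C A) \<and> \<delta>' \<in> carrier (val (Ext \<C>) C' A') \<and>
     a \<in> carrier (Hom \<C> A A') \<and> c \<in> carrier (Hom \<C> C C') \<and>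
     push \<C> C a \<delta> = pull \<C> A' c \<delta>'"

definition sequences :: "('o, 'm, 'z) cat_scheme \<Rightarrow> 'o \<Rightarrow> 'o \<Rightarrow> ('o \<times> 'm \<times> 'm) set" where
  "sequences \<C> A C =
     {(B, k, p). B \<in> Obj \<C> \<and> k \<in> carrier (Hom \<C> A B) \<and> p \<in> carrier (Hom \<C> B C)}"

definition seq_equiv ::
  "('o, 'm, 'z) cat_scheme \<Rightarrow> 'o \<Rightarrow> 'o \<Rightarrow> (('o \<times> 'm \<times> 'm) \<times> ('o \<times> 'm \<times> 'm)) set" where
  "seq_equiv \<C> A C =
     {((B, k, p), (B', k', p')).
        (B, k, p) \<in> sequences \<C> A C \<and> (B', k', p') \<in> sequences \<C> A C \<and>
        (\<exists>b. isomorphism \<C> B B' b \<and> b \<cdot>\<^bsub>\<C>\<^esub> k = k' \<and> p' \<cdot>\<^bsub>\<C>\<^esub> b = p)}"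

definition s_triangle ::
  "('o, 'm, 'e, 'z) extri_scheme \<Rightarrow> 'o \<Rightarrow> 'm \<Rightarrow> 'o \<Rightarrow> 'm \<Rightarrow> 'o \<Rightarrow> 'e \<Rightarrow> bool" where
  "s_triangle \<C> A k B p C \<delta> \<longleftrightarrow>
     A \<in> Obj \<C> \<and> B \<in> Obj \<C> \<and> C \<in> Obj \<C> \<and> \<delta> \<in> carrier (val (Ext \<C>) C A) \<and>
     (B, k, p) \<in> realization \<C> C A \<delta>"

definition inflation :: "('o, 'm, 'e, 'z) extri_scheme \<Rightarrow> 'o \<Rightarrow> 'o \<Rightarrow> 'm \<Rightarrow> bool" where
  "inflation \<C> A B k \<longleftrightarrow> (\<exists>C p \<delta>. s_triangle \<C> A k B p C \<delta>)"

definition deflation :: "('o, 'm, 'e, 'z) extri_scheme \<Rightarrow> 'o \<Rightarrow> 'o \<Rightarrow> 'm \<Rightarrow> bool" where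
  "deflation \<C> B C p \<longleftrightarrow> (\<exists>A k \<delta>. s_triangle \<C> A k B p C \<delta>)"

text \<open>
  The axioms of Nakaoka and Palu. The direct sum \<open>\<delta> \<oplus> \<delta>'\<close> in (ET2) is, as in their definition,
  the element \<open>\<xi>\<close> of \<open>\<bbbE>(C \<oplus> C', A \<oplus> A')\<close> with components \<open>(\<delta>, 0, 0, \<delta>')\<close>; the component in
  \<open>\<bbbE>(C, A')\<close>, for instance, is \<open>\<bbbE>(i\<^sub>C, p\<^sub>A\<^sub>')(\<xi>)\<close>.
\<close>

locale extriangulated_category = additive_category \<C> + Ext: bimodule \<C> "Ext \<C>"
  for \<C> :: "('o, 'm, 'e, 'z) extri_scheme" (structure) +
  assumes realization_class:
      "\<lbrakk>A \<in> Obj \<C>; C \<in> Obj \<C>; \<delta> \<in> carrier (val (Ext \<C>) C A)\<rbrakk>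
        \<Longrightarrow> realization \<C> C A \<delta> \<in> sequences \<C> A C // seq_equiv \<C> A C"
    and ET2_realization:
      "\<lbrakk>s_triangle \<C> A k B p C \<delta>; s_triangle \<C> A' k' B' p' C' \<delta>';
        ext_morphism \<C> C A \<delta> C' A' \<delta>' a c\<rbrakk>
        \<Longrightarrow> \<exists>b \<in> carrier (Hom \<C> B B'). b \<cdot> k = k' \<cdot> a \<and> p' \<cdot> b = c \<cdot> p"
    and ET2_split:
      "biproduct \<C> A C S i\<^sub>1 i\<^sub>2 p\<^sub>1 p\<^sub>2
        \<Longrightarrow> (S, i\<^sub>1, p\<^sub>2) \<in> realization \<C> C A \<one>\<^bsub>val (Ext \<C>) C A\<^esub>"
    and ET2_sum:
      "\<lbrakk>s_triangle \<C> A k B p C \<delta>; s_triangle \<C> A' k' B' p' C' \<delta>';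
        biproduct \<C> A A' SA iA iA' pA pA'; biproduct \<C> B B' SB iB iB' pB pB';
        biproduct \<C> C C' SC iC iC' pC pC';
        \<xi> \<in> carrier (val (Ext \<C>) SC SA);
        act (Ext \<C>) iC pA \<xi> = \<delta>; act (Ext \<C>) iC pA' \<xi> = \<one>\<^bsub>val (Ext \<C>) C A'\<^esub>;
        act (Ext \<C>) iC' pA \<xi> = \<one>\<^bsub>val (Ext \<C>) C' A\<^esub>; act (Ext \<C>) iC' pA' \<xi> = \<delta>'\<rbrakk>
        \<Longrightarrow> (SB, (iB \<cdot> k \<cdot> pA) \<otimes>\<^bsub>Hom \<C> SA SB\<^esub> (iB' \<cdot> k' \<cdot> pA'),
                (iC \<cdot> p \<cdot> pB) \<otimes>\<^bsub>Hom \<C> SB SC\<^esub> (iC' \<cdot> p' \<cdot> pB')) \<in> realization \<C> SC SA \<xi>"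
    and ET3:
      "\<lbrakk>s_triangle \<C> A k B p C \<delta>; s_triangle \<C> A' k' B' p' C' \<delta>';
        a \<in> carrier (Hom \<C> A A'); b \<in> carrier (Hom \<C> B B'); b \<cdot> k = k' \<cdot> a\<rbrakk>
        \<Longrightarrow> \<exists>c. ext_morphism \<C> C A \<delta> C' A' \<delta>' a c \<and> c \<cdot> p = p' \<cdot> b"
    and ET3_op:
      "\<lbrakk>s_triangle \<C> A k B p C \<delta>; s_triangle \<C> A' k' B' p' C' \<delta>';
        b \<in> carrier (Hom \<C> B B'); c \<in> carrier (Hom \<C> C C'); p' \<cdot> b = c \<cdot> p\<rbrakk>
        \<Longrightarrow> \<exists>a. ext_morphism \<C> C A \<delta> C' A' \<delta>' a c \<and> b \<cdot> k = k' \<cdot> a"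
    and ET4:
      "\<lbrakk>s_triangle \<C> A f B f' D \<delta>; s_triangle \<C> B g C g' F \<delta>'\<rbrakk>
        \<Longrightarrow> \<exists>E d e h' \<delta>''.
              s_triangle \<C> A (g \<cdot> f) C h' E \<delta>'' \<and>
              s_triangle \<C> D d E e F (push \<C> F f' \<delta>') \<and>
              h' \<cdot> g = d \<cdot> f' \<and> e \<cdot> h' = g' \<and>
              pull \<C> A d \<delta>'' = \<delta> \<and>
              push \<C> E f \<delta>'' = pull \<C> B e \<delta>'"
    and ET4_op:
      "\<lbrakk>s_triangle \<C> D f' A f B \<delta>; s_triangle \<C> F g' B g C \<delta>'\<rbrakk>
        \<Longrightarrow> \<exists>E d e h' \<delta>''.
              s_triangle \<C> E h' A (g \<cdot> f) C \<delta>'' \<and>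
              s_triangle \<C> D d E e F (pull \<C> D g' \<delta>) \<and>
              h' \<cdot> d = f' \<and> f \<cdot> h' = g' \<cdot> e \<and>
              push \<C> C e \<delta>'' = \<delta>' \<and>
              push \<C> B d \<delta> = pull \<C> E g \<delta>''"


section \<open>Weakly effaceable modules\<close>

text \<open>A one-sided module is given by its groups \<open>G\<close> and its action \<open>\<alpha>\<close> on arrows.\<close>

definition weakly_effaceable_right ::
  "('o, 'm, 'e, 'z) extri_scheme \<Rightarrow> ('o \<Rightarrow> 'g monoid) \<Rightarrow> ('m \<Rightarrow> 'g \<Rightarrow> 'g) \<Rightarrow> bool" where
  "weakly_effaceable_right \<C> G \<alpha> \<longleftrightarrow>
     (\<forall>C \<in> Obj \<C>. \<forall>x \<in> carrier (G C). \<exists>B p. deflation \<C> B C p \<and> \<alpha> p x = \<one>\<^bsub>G B\<^esub>)"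

definition weakly_effaceable_left ::
  "('o, 'm, 'e, 'z) extri_scheme \<Rightarrow> ('o \<Rightarrow> 'g monoid) \<Rightarrow> ('m \<Rightarrow> 'g \<Rightarrow> 'g) \<Rightarrow> bool" where
  "weakly_effaceable_left \<C> G \<alpha> \<longleftrightarrow>
     (\<forall>A \<in> Obj \<C>. \<forall>x \<in> carrier (G A). \<exists>B k. inflation \<C> A B k \<and> \<alpha> k x = \<one>\<^bsub>G B\<^esub>)"

definition weakly_effaceable ::
  "('o, 'm, 'e, 'z) extri_scheme \<Rightarrow> ('o, 'm, 'g) bimod \<Rightarrow> bool" where
  "weakly_effaceable \<C> M \<longleftrightarrow>
     (\<forall>U \<in> Obj \<C>. weakly_effaceable_right \<C> (\<lambda>X. val M X U) (\<lambda>f. act M f (ident \<C> U)) \<and>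
                  weakly_effaceable_left \<C> (\<lambda>X. val M U X) (\<lambda>g. act M (ident \<C> U) g))"


section \<open>Delta-functors\<close>

text \<open>
  For \<open>\<delta> \<in> \<bbbE>(C, A)\<close>, \<open>eps T i C A \<delta> U\<close> is \<open>(\<epsilon>\<^sup>i\<^sub>\<delta>)\<^sub>U : T\<^sup>i(A, U) \<rightarrow> T\<^sup>i\<^sup>+\<^sup>1(C, U)\<close> and
  \<open>eta T i C A \<delta> U\<close> is \<open>(\<eta>\<^sup>i\<^sub>\<delta>)\<^sub>U : T\<^sup>i(U, C) \<rightarrow> T\<^sup>i\<^sup>+\<^sup>1(U, A)\<close>.
\<close>

record ('o, 'm, 'e, 'g) delta_data =
  Fun :: "nat \<Rightarrow> ('o, 'm, 'g) bimod"
  eps :: "nat \<Rightarrow> 'o \<Rightarrow> 'o \<Rightarrow> 'e \<Rightarrow> 'o \<Rightarrow> 'g \<Rightarrow> 'g"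
  eta :: "nat \<Rightarrow> 'o \<Rightarrow> 'o \<Rightarrow> 'e \<Rightarrow> 'o \<Rightarrow> 'g \<Rightarrow> 'g"

text \<open>
  In the library notion \<open>exact_seq\<close> the groups and the maps are listed from right to left, and
  exactness is required at all inner terms. The five-term sequences below, for all \<open>i\<close>, thus
  amount to exactness of the long sequences at every term except the initial one.
\<close>

locale delta_functor = extriangulated_category \<C>
  for \<C> :: "('o, 'm, 'e, 'z) extri_scheme" (structure) +
  fixes T :: "('o, 'm, 'e, 'g) delta_data"
  assumes Fun_bimodule: "bimodule \<C> (Fun T i)"
    and eps_hom:
      "\<lbrakk>A \<in> Obj \<C>; C \<in> Obj \<C>; U \<in> Obj \<C>; \<delta> \<in> carrier (val (Ext \<C>) C A)\<rbrakk>
        \<Longrightarrow> eps T i C A \<delta> U \<in> hom (val (Fun T i) A U) (val (Fun T (Suc i)) C U)"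
    and eps_module:
      "\<lbrakk>A \<in> Obj \<C>; C \<in> Obj \<C>; U \<in> Obj \<C>; U' \<in> Obj \<C>; \<delta> \<in> carrier (val (Ext \<C>) C A);
        g \<in> carrier (Hom \<C> U U'); x \<in> carrier (val (Fun T i) A U)\<rbrakk>
        \<Longrightarrow> eps T i C A \<delta> U' (act (Fun T i) (ident \<C> A) g x)
            = act (Fun T (Suc i)) (ident \<C> C) g (eps T i C A \<delta> U x)"
    and eps_natural:
      "\<lbrakk>A \<in> Obj \<C>; C \<in> Obj \<C>; A' \<in> Obj \<C>; C' \<in> Obj \<C>; U \<in> Obj \<C>;
        ext_morphism \<C> C A \<delta> C' A' \<delta>' a c; x \<in> carrier (val (Fun T i) A' U)\<rbrakk>
        \<Longrightarrow> eps T i C A \<delta> U (act (Fun T i) a (ident \<C> U) x)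
            = act (Fun T (Suc i)) c (ident \<C> U) (eps T i C' A' \<delta>' U x)"
    and eta_hom:
      "\<lbrakk>A \<in> Obj \<C>; C \<in> Obj \<C>; U \<in> Obj \<C>; \<delta> \<in> carrier (val (Ext \<C>) C A)\<rbrakk>
        \<Longrightarrow> eta T i C A \<delta> U \<in> hom (val (Fun T i) U C) (val (Fun T (Suc i)) U A)"
    and eta_module:
      "\<lbrakk>A \<in> Obj \<C>; C \<in> Obj \<C>; U \<in> Obj \<C>; U' \<in> Obj \<C>; \<delta> \<in> carrier (val (Ext \<C>) C A);
        g \<in> carrier (Hom \<C> U' U); x \<in> carrier (val (Fun T i) U C)\<rbrakk>
        \<Longrightarrow> eta T i C A \<delta> U' (act (Fun T i) g (ident \<C> C) x)
            = act (Fun T (Suc i)) g (ident \<C> A) (eta T i C A \<delta> U x)"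
    and eta_natural:
      "\<lbrakk>A \<in> Obj \<C>; C \<in> Obj \<C>; A' \<in> Obj \<C>; C' \<in> Obj \<C>; U \<in> Obj \<C>;
        ext_morphism \<C> C A \<delta> C' A' \<delta>' a c; x \<in> carrier (val (Fun T i) U C)\<rbrakk>
        \<Longrightarrow> eta T i C' A' \<delta>' U (act (Fun T i) (ident \<C> U) c x)
            = act (Fun T (Suc i)) (ident \<C> U) a (eta T i C A \<delta> U x)"
    and eps_exact:
      "\<lbrakk>s_triangle \<C> A k B p C \<delta>; U \<in> Obj \<C>\<rbrakk>
        \<Longrightarrow> exact_seq
             ([val (Fun T (Suc i)) B U, val (Fun T (Suc i)) C U,
               val (Fun T i) A U, val (Fun T i) B U, val (Fun T i) C U],
              [act (Fun T (Suc i)) p (ident \<C> U), eps T i C A \<delta> U,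
               act (Fun T i) k (ident \<C> U), act (Fun T i) p (ident \<C> U)])"
    and eta_exact:
      "\<lbrakk>s_triangle \<C> A k B p C \<delta>; U \<in> Obj \<C>\<rbrakk>
        \<Longrightarrow> exact_seq
             ([val (Fun T (Suc i)) U B, val (Fun T (Suc i)) U A,
               val (Fun T i) U C, val (Fun T i) U B, val (Fun T i) U A],
              [act (Fun T (Suc i)) (ident \<C> U) k, eta T i C A \<delta> U,
               act (Fun T i) (ident \<C> U) p, act (Fun T i) (ident \<C> U) k])"

definition delta_morphism ::
  "('o, 'm, 'e, 'z) extri_scheme \<Rightarrow> ('o, 'm, 'e, 'g) delta_data \<Rightarrow> ('o, 'm, 'e, 'h) delta_data \<Rightarrow>
   (nat \<Rightarrow> 'o \<Rightarrow> 'o \<Rightarrow> 'g \<Rightarrow> 'h) \<Rightarrow> bool" where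
  "delta_morphism \<C> R T \<theta> \<longleftrightarrow>
     (\<forall>i. bimodule_hom \<C> (Fun R i) (Fun T i) (\<theta> i)) \<and>
     (\<forall>i. \<forall>A \<in> Obj \<C>. \<forall>C \<in> Obj \<C>. \<forall>U \<in> Obj \<C>. \<forall>\<delta> \<in> carrier (val (Ext \<C>) C A).
        (\<forall>x \<in> carrier (val (Fun R i) A U).
           \<theta> (Suc i) C U (eps R i C A \<delta> U x) = eps T i C A \<delta> U (\<theta> i A U x)) \<and>
        (\<forall>x \<in> carrier (val (Fun R i) U C).
           \<theta> (Suc i) U A (eta R i C A \<delta> U x) = eta T i C A \<delta> U (\<theta> i U C x)))"

definition delta_isomorphism ::
  "('o, 'm, 'e, 'z) extri_scheme \<Rightarrow> ('o, 'm, 'e, 'g) delta_data \<Rightarrow> ('o, 'm, 'e, 'h) delta_data \<Rightarrow>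
   (nat \<Rightarrow> 'o \<Rightarrow> 'o \<Rightarrow> 'g \<Rightarrow> 'h) \<Rightarrow> bool" where
  "delta_isomorphism \<C> R T \<theta> \<longleftrightarrow>
     delta_morphism \<C> R T \<theta> \<and> (\<forall>i. bimodule_iso \<C> (Fun R i) (Fun T i) (\<theta> i))"

text \<open>
  Since the elements of \<open>T\<^sup>0(X, A)\<close> and the arrows \<open>X \<rightarrow> A\<close> may have different types, the equality
  of \<open>T\<^sup>0\<close> and \<open>Hom\<close> is expressed by a given bimodule isomorphism \<open>\<iota> : Hom \<rightarrow> T\<^sup>0\<close>, through which
  arrows are regarded as elements of \<open>T\<^sup>0\<close>; literal equality is the case where \<open>\<iota>\<close> is the identity.
\<close>

definition ext_identification ::
  "('o, 'm, 'e, 'z) extri_scheme \<Rightarrow> ('o, 'm, 'e, 'g) delta_data \<Rightarrow> ('o \<Rightarrow> 'o \<Rightarrow> 'm \<Rightarrow> 'g) \<Rightarrow>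
   ('o \<Rightarrow> 'o \<Rightarrow> 'g \<Rightarrow> 'e) \<Rightarrow> bool" where
  "ext_identification \<C> T \<iota> \<phi> \<longleftrightarrow>
     bimodule_iso \<C> (Fun T 1) (Ext \<C>) \<phi> \<and>
     (\<forall>A \<in> Obj \<C>. \<forall>C \<in> Obj \<C>. \<forall>U \<in> Obj \<C>.
        \<forall>\<delta> \<in> carrier (val (Ext \<C>) C A). \<forall>f \<in> carrier (Hom \<C> A U).
          \<phi> C U (eps T 0 C A \<delta> U (\<iota> A U f)) = push \<C> C f \<delta>)"

text \<open>
  Given the first two assumptions of the following locale, there is one and only one
  \<open>\<phi>\<close> with \<open>ext_identification \<C> T \<iota> \<phi>\<close>. The assumption \<open>eta_zero\<close> refers to this \<open>\<phi>\<close>; it is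
  phrased so that the existence of \<open>\<phi>\<close> is not itself assumed.
\<close>

locale hom_delta_functor = delta_functor \<C> T
  for \<C> :: "('o, 'm, 'e, 'z) extri_scheme" (structure) and T :: "('o, 'm, 'e, 'g) delta_data" +
  fixes \<iota> :: "'o \<Rightarrow> 'o \<Rightarrow> 'm \<Rightarrow> 'g"
  assumes hom_zero: "bimodule_iso \<C> (hom_bimodule \<C>) (Fun T 0) \<iota>"
    and effaceable: "i > 0 \<Longrightarrow> weakly_effaceable \<C> (Fun T i)"
    and eta_zero:
      "\<lbrakk>ext_identification \<C> T \<iota> \<phi>; A \<in> Obj \<C>; C \<in> Obj \<C>; U \<in> Obj \<C>;
        \<delta> \<in> carrier (val (Ext \<C>) C A); f \<in> carrier (Hom \<C> U C)\<rbrakk>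
        \<Longrightarrow> \<phi> U A (eta T 0 C A \<delta> U (\<iota> U C f)) = pull \<C> A f \<delta>"
    and eta_eps_commute:
      "\<lbrakk>i \<ge> 2; s_triangle \<C> A k B p C \<delta>; s_triangle \<C> F l G q H \<psi>;
        x \<in> carrier (val (Fun T (i - 2)) A H)\<rbrakk>
        \<Longrightarrow> eta T (i - 1) H F \<psi> C (eps T (i - 2) C A \<delta> H x)
            = eps T (i - 1) C A \<delta> F (eta T (i - 2) H F \<psi> A x)"

end

theory Submission
  imports Defs
begin

text \<open>
  The theorem is a form of the universality of effaceable \<open>\<delta>\<close>-functors. Let \<open>\<delta> \<in> \<bbbE>(C, A)\<close> be
  realized by \<open>A \<rightarrow> B \<rightarrow> C\<close> with arrows \<open>k\<close> and \<open>p\<close>. If \<open>x \<in> R\<^sup>i\<^sup>+\<^sup>1(C, U)\<close> is killed by \<open>p\<close>, then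
  exactness gives \<open>x = \<epsilon>\<^sub>\<delta>(y)\<close> for some \<open>y \<in> R\<^sup>i(A, U)\<close>, and by weak effaceability every \<open>x\<close> is killed
  by some deflation. Compatibility with \<open>\<epsilon>\<close> therefore forces \<open>\<theta>\<^sup>i\<^sup>+\<^sup>1(x) = \<epsilon>\<^sub>\<delta>(\<theta>\<^sup>i(y))\<close>. This is the
  uniqueness (\<open>delta_morphism_unique\<close>), and it is also how \<open>\<theta>\<close> is constructed by recursion.

  The formula is unambiguous for two reasons. For a fixed \<open>\<delta>\<close>, the kernel of \<open>\<epsilon>\<^sub>\<delta>\<close> is the image of \<open>k\<close>,
  and the bimodule morphism \<open>\<theta>\<^sup>i\<close> carries the image of \<open>k\<close> into the image of \<open>k\<close>. Two different
  extensions \<open>\<delta> \<in> \<bbbE>(C, A)\<close> and \<open>\<delta>' \<in> \<bbbE>(C, A')\<close> are both pushouts of the single extension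
  \<open>i\<^sub>*\<delta> + i'\<^sub>*\<delta>' \<in> \<bbbE>(C, A \<oplus> A')\<close> (\<open>common_extension\<close>), so naturality of \<open>\<epsilon>\<close> reduces them to the
  same \<open>\<delta>\<close>. The same device shows that \<open>\<theta>\<^sup>i\<^sup>+\<^sup>1\<close> is additive. If \<open>\<theta>\<^sup>i\<close> is an isomorphism, then a diagram
  chase makes \<open>\<theta>\<^sup>i\<^sup>+\<^sup>1\<close> one (\<open>extend_hom_bimodule_iso\<close>).

  Compatibility with \<open>\<eta>\<close> is a separate induction (\<open>comparison_eta\<close>). For \<open>i > 0\<close> every element of
  \<open>R\<^sup>i\<close> is some \<open>\<epsilon>\<^sub>\<delta>(y)\<close>, and \<open>\<eta>\<close> commutes with \<open>\<epsilon>\<close>, which moves the claim one degree down. For \<open>i = 0\<close>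
  both \<open>\<eta>\<^sub>\<psi>(f)\<close> and \<open>\<epsilon>\<^bsub>f\<^sup>*\<psi>\<^esub>(id)\<close> correspond to \<open>f\<^sup>*\<psi>\<close> under the identification of the first term
  with \<open>\<bbbE>\<close>, so they are equal, and compatibility with \<open>\<epsilon>\<close> applies. The identification
  itself comes from the same extension principle, applied to the pair \<open>(Hom, \<bbbE>)\<close> with the
  connecting map \<open>f \<mapsto> f\<^sub>*\<delta>\<close> as the target; so the principle is stated for an arbitrary pair of
  bimodules with a connecting map (locale \<open>connecting_map\<close>).
\<close>

section \<open>Bimodules\<close>

context bimodule begin

lemma act_closed:
  "\<lbrakk>X \<in> Obj \<C>; X' \<in> Obj \<C>; A \<in> Obj \<C>; A' \<in> Obj \<C>;
    f \<in> carrier (Hom \<C> X' X); g \<in> carrier (Hom \<C> A A'); x \<in> carrier (val M X A)\<rbrakk>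
    \<Longrightarrow> act M f g x \<in> carrier (val M X' A')"
  by (rule hom_in_carrier[OF act_hom])

lemma act_zero:
  "\<lbrakk>X \<in> Obj \<C>; X' \<in> Obj \<C>; A \<in> Obj \<C>; A' \<in> Obj \<C>;
    f \<in> carrier (Hom \<C> X' X); g \<in> carrier (Hom \<C> A A')\<rbrakk>
    \<Longrightarrow> act M f g \<one>\<^bsub>val M X A\<^esub> = \<one>\<^bsub>val M X' A'\<^esub>"
  by (rule hom_one[OF act_hom]) (simp_all add: val_group comm_group.axioms(2))

lemma act_mult:
  "\<lbrakk>X \<in> Obj \<C>; X' \<in> Obj \<C>; A \<in> Obj \<C>; A' \<in> Obj \<C>;
    f \<in> carrier (Hom \<C> X' X); g \<in> carrier (Hom \<C> A A');
    x \<in> carrier (val M X A); y \<in> carrier (val M X A)\<rbrakk>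
    \<Longrightarrow> act M f g (x \<otimes>\<^bsub>val M X A\<^esub> y) = act M f g x \<otimes>\<^bsub>val M X' A'\<^esub> act M f g y"
  by (rule hom_mult[OF act_hom])

lemma act_split:
  assumes "X \<in> Obj \<C>" "X' \<in> Obj \<C>" "A \<in> Obj \<C>" "A' \<in> Obj \<C>"
    "f \<in> carrier (Hom \<C> X' X)" "g \<in> carrier (Hom \<C> A A')" "x \<in> carrier (val M X A)"
  shows "act M f (ident \<C> A') (act M (ident \<C> X) g x) = act M f g x"
    and "act M (ident \<C> X') g (act M f (ident \<C> A) x) = act M f g x"
  using act_comp[of X X X' A A' A' "ident \<C> X" f g "ident \<C> A'" x]
    act_comp[of X X' X' A A A' f "ident \<C> X'" "ident \<C> A" g x] assms
  by (simp_all add: ident_in_hom comp_ident_left comp_ident_right)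

lemma act_hom_zero_right:
  assumes "X \<in> Obj \<C>" "X' \<in> Obj \<C>" "A \<in> Obj \<C>" "A' \<in> Obj \<C>"
    "f \<in> carrier (Hom \<C> X' X)" "x \<in> carrier (val M X A)"
  shows "act M f \<one>\<^bsub>Hom \<C> A A'\<^esub> x = \<one>\<^bsub>val M X' A'\<^esub>"
proof -
  interpret H: comm_group "Hom \<C> A A'" using hom_group assms by blast
  interpret V: comm_group "val M X' A'" using val_group assms by blast
  have "act M f \<one>\<^bsub>Hom \<C> A A'\<^esub> x \<otimes>\<^bsub>val M X' A'\<^esub> act M f \<one>\<^bsub>Hom \<C> A A'\<^esub> x = act M f \<one>\<^bsub>Hom \<C> A A'\<^esub> x"
    using act_add_right[of X X' A A' f "\<one>\<^bsub>Hom \<C> A A'\<^esub>" "\<one>\<^bsub>Hom \<C> A A'\<^esub>" x] assms by simp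
  then show ?thesis
    using act_closed[of X X' A A' f "\<one>\<^bsub>Hom \<C> A A'\<^esub>" x] assms by simp
qed

end

lemma bimodule_homD:
  assumes "bimodule_hom \<C> M N \<theta>"
  shows "\<lbrakk>X \<in> Obj \<C>; A \<in> Obj \<C>\<rbrakk> \<Longrightarrow> \<theta> X A \<in> hom (val M X A) (val N X A)"
    and "\<lbrakk>X \<in> Obj \<C>; X' \<in> Obj \<C>; A \<in> Obj \<C>; A' \<in> Obj \<C>;
          f \<in> carrier (Hom \<C> X' X); g \<in> carrier (Hom \<C> A A'); x \<in> carrier (val M X A)\<rbrakk>
          \<Longrightarrow> \<theta> X' A' (act M f g x) = act N f g (\<theta> X A x)"
  using assms unfolding bimodule_hom_def by blast+

lemma bimodule_hom_closed:
  "\<lbrakk>bimodule_hom \<C> M N \<theta>; X \<in> Obj \<C>; A \<in> Obj \<C>; x \<in> carrier (val M X A)\<rbrakk>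
    \<Longrightarrow> \<theta> X A x \<in> carrier (val N X A)"
  by (rule hom_in_carrier[OF bimodule_homD(1)])

lemma bimodule_iso_bij:
  "\<lbrakk>bimodule_iso \<C> M N \<theta>; X \<in> Obj \<C>; A \<in> Obj \<C>\<rbrakk>
    \<Longrightarrow> bij_betw (\<theta> X A) (carrier (val M X A)) (carrier (val N X A))"
  by (simp add: bimodule_iso_def iso_def)

definition bimodule_inv ::
  "('o, 'm, 'g) bimod \<Rightarrow> ('o \<Rightarrow> 'o \<Rightarrow> 'g \<Rightarrow> 'h) \<Rightarrow> 'o \<Rightarrow> 'o \<Rightarrow> 'h \<Rightarrow> 'g" where
  "bimodule_inv M \<theta> X A = inv_into (carrier (val M X A)) (\<theta> X A)"

lemma bimodule_inv_left:
  "\<lbrakk>bimodule_iso \<C> M N \<theta>; X \<in> Obj \<C>; A \<in> Obj \<C>; x \<in> carrier (val M X A)\<rbrakk>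
    \<Longrightarrow> bimodule_inv M \<theta> X A (\<theta> X A x) = x"
  unfolding bimodule_inv_def using bimodule_iso_bij bij_betw_inv_into_left by metis

lemma bimodule_inv_right:
  "\<lbrakk>bimodule_iso \<C> M N \<theta>; X \<in> Obj \<C>; A \<in> Obj \<C>; y \<in> carrier (val N X A)\<rbrakk>
    \<Longrightarrow> \<theta> X A (bimodule_inv M \<theta> X A y) = y"
  unfolding bimodule_inv_def using bimodule_iso_bij bij_betw_inv_into_right by metis

lemma bimodule_iso_inv:
  assumes M: "bimodule \<C> M" and iso: "bimodule_iso \<C> M N \<theta>"
  shows "bimodule_iso \<C> N M (bimodule_inv M \<theta>)"
proof -
  interpret bimodule \<C> M by (rule M)
  have hom: "bimodule_hom \<C> M N \<theta>" using iso by (simp add: bimodule_iso_def)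
  have inv_iso: "bimodule_inv M \<theta> X A \<in> iso (val N X A) (val M X A)"
    if "X \<in> Obj \<C>" "A \<in> Obj \<C>" for X A
    unfolding bimodule_inv_def
    by (rule group.iso_set_sym)
      (use iso that in \<open>simp_all add: bimodule_iso_def comm_group.axioms(2)[OF val_group]\<close>)
  have "bimodule_inv M \<theta> X' A' (act N f g y) = act M f g (bimodule_inv M \<theta> X A y)"
    if *: "X \<in> Obj \<C>" "X' \<in> Obj \<C>" "A \<in> Obj \<C>" "A' \<in> Obj \<C>" "f \<in> carrier (Hom \<C> X' X)"
      "g \<in> carrier (Hom \<C> A A')" "y \<in> carrier (val N X A)" for X X' A A' f g y
  proof -
    define x where "x = bimodule_inv M \<theta> X A y"
    have x: "x \<in> carrier (val M X A)" and y: "y = \<theta> X A x"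
      using inv_iso[of X A] bimodule_inv_right[OF iso, of X A y] that
      by (auto simp: x_def iso_def hom_def)
    have "act N f g y = \<theta> X' A' (act M f g x)"
      using bimodule_homD(2)[OF hom] that x y by simp
    then show ?thesis
      using bimodule_inv_left[OF iso] act_closed that x by (simp add: x_def)
  qed
  then show ?thesis
    using inv_iso by (auto simp: bimodule_iso_def bimodule_hom_def iso_def)
qed

lemma bimodule_iso_comp:
  assumes "bimodule_iso \<C> M N \<theta>" "bimodule_iso \<C> N P \<kappa>"
  shows "bimodule_iso \<C> M P (\<lambda>X A x. \<kappa> X A (\<theta> X A x))"
proof -
  have "(\<lambda>x. \<kappa> X A (\<theta> X A x)) \<in> iso (val M X A) (val P X A)"
    if "X \<in> Obj \<C>" "A \<in> Obj \<C>" for X A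
    using iso_set_trans[of "\<theta> X A" "val M X A" "val N X A" "\<kappa> X A" "val P X A"] assms that
    by (simp add: bimodule_iso_def compose_def comp_def)
  moreover have "bimodule_hom \<C> M N \<theta>" "bimodule_hom \<C> N P \<kappa>"
    using assms by (simp_all add: bimodule_iso_def)
  ultimately show ?thesis
    by (auto simp: bimodule_iso_def bimodule_hom_def[of _ M P] iso_def
        bimodule_homD(2) bimodule_hom_closed)
qed

section \<open>Extensions in an extriangulated category\<close>

context extriangulated_category begin

lemma ext_zero_closed:
  "\<lbrakk>C \<in> Obj \<C>; A \<in> Obj \<C>\<rbrakk> \<Longrightarrow> \<one>\<^bsub>val (Ext \<C>) C A\<^esub> \<in> carrier (val (Ext \<C>) C A)"
  by (meson Ext.val_group comm_group.axioms(2) group.is_monoid monoid.one_closed)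

lemma push_closed:
  "\<lbrakk>C \<in> Obj \<C>; A \<in> Obj \<C>; A' \<in> Obj \<C>; a \<in> carrier (Hom \<C> A A'); \<delta> \<in> carrier (val (Ext \<C>) C A)\<rbrakk>
    \<Longrightarrow> push \<C> C a \<delta> \<in> carrier (val (Ext \<C>) C A')"
  by (simp add: push_def Ext.act_closed ident_in_hom)

lemma pull_closed:
  "\<lbrakk>C \<in> Obj \<C>; C' \<in> Obj \<C>; A \<in> Obj \<C>; c \<in> carrier (Hom \<C> C' C); \<delta> \<in> carrier (val (Ext \<C>) C A)\<rbrakk>
    \<Longrightarrow> pull \<C> A c \<delta> \<in> carrier (val (Ext \<C>) C' A)"
  by (simp add: pull_def Ext.act_closed ident_in_hom)

lemma push_comp:
  assumes "C \<in> Obj \<C>" "A \<in> Obj \<C>" "B \<in> Obj \<C>" "D \<in> Obj \<C>" "f \<in> carrier (Hom \<C> A B)"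
    "g \<in> carrier (Hom \<C> B D)" "\<delta> \<in> carrier (val (Ext \<C>) C A)"
  shows "push \<C> C (g \<cdot> f) \<delta> = push \<C> C g (push \<C> C f \<delta>)"
  using Ext.act_comp[of C C C A B D "ident \<C> C" "ident \<C> C" f g \<delta>] assms
  by (simp add: push_def ident_in_hom comp_ident_right)

lemma push_mult:
  assumes "C \<in> Obj \<C>" "A \<in> Obj \<C>" "A' \<in> Obj \<C>" "a \<in> carrier (Hom \<C> A A')"
    "\<delta> \<in> carrier (val (Ext \<C>) C A)" "\<delta>' \<in> carrier (val (Ext \<C>) C A)"
  shows "push \<C> C a (\<delta> \<otimes>\<^bsub>val (Ext \<C>) C A\<^esub> \<delta>') = push \<C> C a \<delta> \<otimes>\<^bsub>val (Ext \<C>) C A'\<^esub> push \<C> C a \<delta>'"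
  using assms by (simp add: push_def Ext.act_mult ident_in_hom)

lemma push_ident:
  "\<lbrakk>C \<in> Obj \<C>; A \<in> Obj \<C>; \<delta> \<in> carrier (val (Ext \<C>) C A)\<rbrakk> \<Longrightarrow> push \<C> C (ident \<C> A) \<delta> = \<delta>"
  by (simp add: push_def Ext.act_ident)

lemma pull_ident:
  "\<lbrakk>C \<in> Obj \<C>; A \<in> Obj \<C>; \<delta> \<in> carrier (val (Ext \<C>) C A)\<rbrakk> \<Longrightarrow> pull \<C> A (ident \<C> C) \<delta> = \<delta>"
  by (simp add: pull_def Ext.act_ident)

lemma pull_zero:
  "\<lbrakk>C \<in> Obj \<C>; C' \<in> Obj \<C>; A \<in> Obj \<C>; c \<in> carrier (Hom \<C> C' C)\<rbrakk>
    \<Longrightarrow> pull \<C> A c \<one>\<^bsub>val (Ext \<C>) C A\<^esub> = \<one>\<^bsub>val (Ext \<C>) C' A\<^esub>"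
  by (simp add: pull_def Ext.act_zero ident_in_hom)

lemma push_zero:
  "\<lbrakk>C \<in> Obj \<C>; A \<in> Obj \<C>; A' \<in> Obj \<C>; a \<in> carrier (Hom \<C> A A')\<rbrakk>
    \<Longrightarrow> push \<C> C a \<one>\<^bsub>val (Ext \<C>) C A\<^esub> = \<one>\<^bsub>val (Ext \<C>) C A'\<^esub>"
  by (simp add: push_def Ext.act_zero ident_in_hom)

lemma ext_morphism_pull:
  assumes "C \<in> Obj \<C>" "C' \<in> Obj \<C>" "A \<in> Obj \<C>" "c \<in> carrier (Hom \<C> C' C)"
    "\<delta> \<in> carrier (val (Ext \<C>) C A)"
  shows "ext_morphism \<C> C' A (pull \<C> A c \<delta>) C A \<delta> (ident \<C> A) c"
  using assms by (simp add: ext_morphism_def push_ident pull_closed ident_in_hom)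

lemma ext_morphism_push:
  assumes "C \<in> Obj \<C>" "A \<in> Obj \<C>" "A' \<in> Obj \<C>" "a \<in> carrier (Hom \<C> A A')"
    "\<delta> \<in> carrier (val (Ext \<C>) C A)"
  shows "ext_morphism \<C> C A \<delta> C A' (push \<C> C a \<delta>) a (ident \<C> C)"
  using assms by (simp add: ext_morphism_def pull_ident push_closed ident_in_hom)

lemma realization_nonempty:
  assumes A: "A \<in> Obj \<C>" and C: "C \<in> Obj \<C>" and d: "\<delta> \<in> carrier (val (Ext \<C>) C A)"
  shows "\<exists>B k p. s_triangle \<C> A k B p C \<delta>"
proof -
  obtain B k p where s: "(B, k, p) \<in> sequences \<C> A C"
    and r: "realization \<C> C A \<delta> = seq_equiv \<C> A C `` {(B, k, p)}"
    using realization_class[OF assms] by (auto elim!: quotientE)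
  have "isomorphism \<C> B B (ident \<C> B)"
    using s by (auto simp: isomorphism_def sequences_def ident_in_hom comp_ident_left)
  then have "((B, k, p), (B, k, p)) \<in> seq_equiv \<C> A C"
    using s A C unfolding seq_equiv_def sequences_def
    by (auto intro!: exI[of _ "ident \<C> B"] simp: comp_ident_left comp_ident_right)
  then have "s_triangle \<C> A k B p C \<delta>"
    using assms s r by (auto simp: s_triangle_def sequences_def)
  then show ?thesis by blast
qed

lemma s_triangleD:
  assumes "s_triangle \<C> A k B p C \<delta>"
  shows "A \<in> Obj \<C>" "B \<in> Obj \<C>" "C \<in> Obj \<C>" "\<delta> \<in> carrier (val (Ext \<C>) C A)"
    "k \<in> carrier (Hom \<C> A B)" "p \<in> carrier (Hom \<C> B C)"
proof -
  show *: "A \<in> Obj \<C>" "B \<in> Obj \<C>" "C \<in> Obj \<C>" "\<delta> \<in> carrier (val (Ext \<C>) C A)"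
    using assms by (auto simp: s_triangle_def)
  have "(B, k, p) \<in> realization \<C> C A \<delta>" using assms by (simp add: s_triangle_def)
  moreover have "realization \<C> C A \<delta> \<subseteq> sequences \<C> A C"
    using realization_class[OF *(1) *(3) *(4)] by (auto elim!: quotientE simp: seq_equiv_def)
  ultimately show "k \<in> carrier (Hom \<C> A B)" "p \<in> carrier (Hom \<C> B C)"
    by (auto simp: sequences_def)
qed

lemma split_triangle:
  assumes "biproduct \<C> A C S i\<^sub>1 i\<^sub>2 p\<^sub>1 p\<^sub>2"
  shows "s_triangle \<C> A i\<^sub>1 S p\<^sub>2 C \<one>\<^bsub>val (Ext \<C>) C A\<^esub>"
  using ET2_split[OF assms] assms by (simp add: s_triangle_def biproduct_def ext_zero_closed)

text \<open>
  The projection \<open>A \<oplus> B \<rightarrow> B\<close> and \<open>p\<close> form a commuting square from the split triangle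
  \<open>A \<rightarrow> A \<oplus> B \<rightarrow> B\<close> to the given one. The dual of (ET3) completes it to a morphism of extensions
  from \<open>0\<close> to \<open>\<delta>\<close> over \<open>p\<close>, which exhibits \<open>p\<^sup>*\<delta>\<close> as a pushout of zero.
\<close>

lemma pull_deflation:
  assumes t: "s_triangle \<C> A k B p C \<delta>"
  shows "pull \<C> A p \<delta> = \<one>\<^bsub>val (Ext \<C>) B A\<^esub>"
proof -
  note o = s_triangleD[OF t]
  obtain S i\<^sub>1 i\<^sub>2 p\<^sub>1 p\<^sub>2 where bi: "biproduct \<C> A B S i\<^sub>1 i\<^sub>2 p\<^sub>1 p\<^sub>2"
    using biproduct_exists o by blast
  then have "p\<^sub>2 \<in> carrier (Hom \<C> S B)" by (simp add: biproduct_def)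
  then obtain a where "ext_morphism \<C> B A \<one>\<^bsub>val (Ext \<C>) B A\<^esub> C A \<delta> a p"
    using ET3_op[OF split_triangle[OF bi] t, of p\<^sub>2 p] o by auto
  then show ?thesis
    using push_zero[of B A A a] o by (simp add: ext_morphism_def)
qed

lemma push_inflation:
  assumes t: "s_triangle \<C> A k B p C \<delta>"
  shows "push \<C> C k \<delta> = \<one>\<^bsub>val (Ext \<C>) C B\<^esub>"
proof -
  note o = s_triangleD[OF t]
  obtain S i\<^sub>1 i\<^sub>2 p\<^sub>1 p\<^sub>2 where bi: "biproduct \<C> B C S i\<^sub>1 i\<^sub>2 p\<^sub>1 p\<^sub>2"
    using biproduct_exists o by blast
  then have "i\<^sub>1 \<in> carrier (Hom \<C> B S)" by (simp add: biproduct_def)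
  then obtain c where "ext_morphism \<C> C A \<delta> C B \<one>\<^bsub>val (Ext \<C>) C B\<^esub> k c"
    using ET3[OF t split_triangle[OF bi], of k i\<^sub>1] o by auto
  then show ?thesis
    using pull_zero[of C C B c] o by (simp add: ext_morphism_def)
qed

text \<open>
  A morphism from \<open>\<delta>\<close> to the zero extension is realized by a map from \<open>B\<close> into the middle term
  \<open>U \<oplus> C\<close> of the split triangle; its component in \<open>U\<close> is the factorization.
\<close>

lemma push_zero_factors:
  assumes t: "s_triangle \<C> A k B p C \<delta>" and U: "U \<in> Obj \<C>" and f: "f \<in> carrier (Hom \<C> A U)"
    and z: "push \<C> C f \<delta> = \<one>\<^bsub>val (Ext \<C>) C U\<^esub>"
  shows "\<exists>g \<in> carrier (Hom \<C> B U). f = g \<cdot> k"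
proof -
  note o = s_triangleD[OF t]
  obtain S i\<^sub>1 i\<^sub>2 p\<^sub>1 p\<^sub>2 where bi: "biproduct \<C> U C S i\<^sub>1 i\<^sub>2 p\<^sub>1 p\<^sub>2"
    using biproduct_exists o U by blast
  then have S: "S \<in> Obj \<C>" "i\<^sub>1 \<in> carrier (Hom \<C> U S)" "p\<^sub>1 \<in> carrier (Hom \<C> S U)"
    "p\<^sub>1 \<cdot> i\<^sub>1 = ident \<C> U" by (simp_all add: biproduct_def)
  have "ext_morphism \<C> C A \<delta> C U \<one>\<^bsub>val (Ext \<C>) C U\<^esub> f (ident \<C> C)"
    using ext_morphism_push[of C A U f \<delta>] o U f z by simp
  then obtain b where b: "b \<in> carrier (Hom \<C> B S)" "b \<cdot> k = i\<^sub>1 \<cdot> f"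
    using ET2_realization[OF t split_triangle[OF bi]] by blast
  have "f = (p\<^sub>1 \<cdot> i\<^sub>1) \<cdot> f" using S(4) o U f by (simp add: comp_ident_left)
  also have "\<dots> = (p\<^sub>1 \<cdot> b) \<cdot> k"
    using o U S f b comp_assoc[of A U S U f i\<^sub>1 p\<^sub>1] comp_assoc[of A B S U k b p\<^sub>1] by simp
  finally show ?thesis
    using comp_in_hom[of B S U b p\<^sub>1] o U S b by auto
qed

text \<open>
  If \<open>p\<^sup>*\<epsilon> = 0\<close>, then \<open>p\<close> lifts along the deflation \<open>q\<close> of a triangle \<open>U \<rightarrow> V \<rightarrow> C\<close> of \<open>\<epsilon>\<close>: realize the
  morphism from the zero extension to \<open>\<epsilon>\<close> over \<open>p\<close> and restrict to the summand \<open>B\<close>. The dual of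
  (ET3) turns the lift into a morphism of extensions over the identity of \<open>C\<close>.
\<close>

lemma pull_zero_push:
  assumes t: "s_triangle \<C> A k B p C \<delta>" and U: "U \<in> Obj \<C>"
    and e: "\<epsilon> \<in> carrier (val (Ext \<C>) C U)" and z: "pull \<C> U p \<epsilon> = \<one>\<^bsub>val (Ext \<C>) B U\<^esub>"
  shows "\<exists>f \<in> carrier (Hom \<C> A U). push \<C> C f \<delta> = \<epsilon>"
proof -
  note o = s_triangleD[OF t]
  obtain V l q where t': "s_triangle \<C> U l V q C \<epsilon>"
    using realization_nonempty U o(3) e by blast
  note o' = s_triangleD[OF t']
  obtain S i\<^sub>1 i\<^sub>2 p\<^sub>1 p\<^sub>2 where bi: "biproduct \<C> U B S i\<^sub>1 i\<^sub>2 p\<^sub>1 p\<^sub>2"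
    using biproduct_exists o U by blast
  then have S: "S \<in> Obj \<C>" "i\<^sub>2 \<in> carrier (Hom \<C> B S)" "p\<^sub>2 \<in> carrier (Hom \<C> S B)"
    "p\<^sub>2 \<cdot> i\<^sub>2 = ident \<C> B" by (simp_all add: biproduct_def)
  have "ext_morphism \<C> B U \<one>\<^bsub>val (Ext \<C>) B U\<^esub> C U \<epsilon> (ident \<C> U) p"
    using ext_morphism_pull[of C B U p \<epsilon>] o U e z by simp
  then obtain b where b: "b \<in> carrier (Hom \<C> S V)" "q \<cdot> b = p \<cdot> p\<^sub>2"
    using ET2_realization[OF split_triangle[OF bi] t'] by blast
  have bi2: "b \<cdot> i\<^sub>2 \<in> carrier (Hom \<C> B V)" using comp_in_hom[of B S V] S b o o' by simp
  have "q \<cdot> (b \<cdot> i\<^sub>2) = p \<cdot> (p\<^sub>2 \<cdot> i\<^sub>2)"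
    using comp_assoc[of B S V C i\<^sub>2 b q] comp_assoc[of B S B C i\<^sub>2 p\<^sub>2 p] o o' S b by simp
  also have "\<dots> = ident \<C> C \<cdot> p"
    using S o by (simp add: comp_ident_left comp_ident_right)
  finally obtain a where a: "ext_morphism \<C> C A \<delta> C U \<epsilon> a (ident \<C> C)"
    using ET3_op[OF t t' bi2, of "ident \<C> C"] ident_in_hom o by blast
  then have "a \<in> carrier (Hom \<C> A U)" "push \<C> C a \<delta> = \<epsilon>"
    using pull_ident[of C U \<epsilon>] o U e by (simp_all add: ext_morphism_def)
  then show ?thesis by blast
qed

text \<open>
  The extension \<open>i\<^sub>*\<delta> + i'\<^sub>*\<delta>'\<close> by \<open>A \<oplus> A'\<close> is the pullback of \<open>\<delta> \<oplus> \<delta>'\<close> along the diagonal of \<open>C\<close>; the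
  projections of \<open>A \<oplus> A'\<close> recover \<open>\<delta>\<close> and \<open>\<delta>'\<close>. It plays the part that a common refinement of two
  deflations onto \<open>C\<close> plays in the classical argument for exact categories.
\<close>

lemma common_extension:
  assumes C: "C \<in> Obj \<C>" and A: "A \<in> Obj \<C>" "A' \<in> Obj \<C>"
    and d: "\<delta> \<in> carrier (val (Ext \<C>) C A)" "\<delta>' \<in> carrier (val (Ext \<C>) C A')"
  shows "\<exists>D \<xi> q q'. D \<in> Obj \<C> \<and> \<xi> \<in> carrier (val (Ext \<C>) C D) \<and>
           q \<in> carrier (Hom \<C> D A) \<and> q' \<in> carrier (Hom \<C> D A') \<and>
           push \<C> C q \<xi> = \<delta> \<and> push \<C> C q' \<xi> = \<delta>'"
proof -
  obtain D i i' q q' where "biproduct \<C> A A' D i i' q q'"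
    using biproduct_exists A by blast
  then have D: "D \<in> Obj \<C>" "i \<in> carrier (Hom \<C> A D)" "i' \<in> carrier (Hom \<C> A' D)"
      "q \<in> carrier (Hom \<C> D A)" "q' \<in> carrier (Hom \<C> D A')"
      "q \<cdot> i = ident \<C> A" "q' \<cdot> i' = ident \<C> A'"
      "q' \<cdot> i = \<one>\<^bsub>Hom \<C> A A'\<^esub>" "q \<cdot> i' = \<one>\<^bsub>Hom \<C> A' A\<^esub>"
    by (simp_all add: biproduct_def)
  define \<xi> where "\<xi> = push \<C> C i \<delta> \<otimes>\<^bsub>val (Ext \<C>) C D\<^esub> push \<C> C i' \<delta>'"
  interpret V: comm_group "val (Ext \<C>) C D" by (rule Ext.val_group[OF C D(1)])
  interpret VA: comm_group "val (Ext \<C>) C A" by (rule Ext.val_group[OF C A(1)])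
  interpret VA': comm_group "val (Ext \<C>) C A'" by (rule Ext.val_group[OF C A(2)])
  have cl: "push \<C> C i \<delta> \<in> carrier (val (Ext \<C>) C D)" "push \<C> C i' \<delta>' \<in> carrier (val (Ext \<C>) C D)"
    using push_closed C A d D by blast+
  have z: "push \<C> C \<one>\<^bsub>Hom \<C> A A'\<^esub> \<delta> = \<one>\<^bsub>val (Ext \<C>) C A'\<^esub>"
    "push \<C> C \<one>\<^bsub>Hom \<C> A' A\<^esub> \<delta>' = \<one>\<^bsub>val (Ext \<C>) C A\<^esub>"
    unfolding push_def using Ext.act_hom_zero_right C A d ident_in_hom by blast+
  have "push \<C> C q \<xi> = push \<C> C (q \<cdot> i) \<delta> \<otimes>\<^bsub>val (Ext \<C>) C A\<^esub> push \<C> C (q \<cdot> i') \<delta>'"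
    unfolding \<xi>_def using cl C A d D(1-5) by (simp add: push_mult push_comp)
  then have 1: "push \<C> C q \<xi> = \<delta>" using D z C A d by (simp add: push_ident)
  have "push \<C> C q' \<xi> = push \<C> C (q' \<cdot> i) \<delta> \<otimes>\<^bsub>val (Ext \<C>) C A'\<^esub> push \<C> C (q' \<cdot> i') \<delta>'"
    unfolding \<xi>_def using cl C A d D(1-5) by (simp add: push_mult push_comp)
  then have 2: "push \<C> C q' \<xi> = \<delta>'" using D z C A d by (simp add: push_ident)
  have "\<xi> \<in> carrier (val (Ext \<C>) C D)" using cl by (simp add: \<xi>_def)
  then show ?thesis using D 1 2 by blast
qed

end

section \<open>Connecting maps out of a bimodule\<close>

text \<open>
  This isolates what a single degree of a \<open>\<delta>\<close>-functor contributes to the comparison: the connecting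
  map \<open>\<epsilon>\<^sup>i\<close>, exactness on both sides of it, and effaceability of the target. Both \<open>(T\<^sup>i, T\<^sup>i\<^sup>+\<^sup>1)\<close>
  and \<open>(Hom, \<bbbE>)\<close> are instances.
\<close>

locale connecting_map =
  extriangulated_category \<C> + source: bimodule \<C> M + target: bimodule \<C> N
  for \<C> :: "('o, 'm, 'e, 'z) extri_scheme" (structure)
    and M :: "('o, 'm, 'g) bimod" and N :: "('o, 'm, 'h) bimod" +
  fixes e :: "'o \<Rightarrow> 'o \<Rightarrow> 'e \<Rightarrow> 'o \<Rightarrow> 'g \<Rightarrow> 'h"
  assumes connecting_hom:
      "\<lbrakk>A \<in> Obj \<C>; C \<in> Obj \<C>; U \<in> Obj \<C>; \<delta> \<in> carrier (val (Ext \<C>) C A)\<rbrakk>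
        \<Longrightarrow> e C A \<delta> U \<in> hom (val M A U) (val N C U)"
    and connecting_module:
      "\<lbrakk>A \<in> Obj \<C>; C \<in> Obj \<C>; U \<in> Obj \<C>; U' \<in> Obj \<C>; \<delta> \<in> carrier (val (Ext \<C>) C A);
        g \<in> carrier (Hom \<C> U U'); x \<in> carrier (val M A U)\<rbrakk>
        \<Longrightarrow> e C A \<delta> U' (act M (ident \<C> A) g x) = act N (ident \<C> C) g (e C A \<delta> U x)"
    and connecting_natural:
      "\<lbrakk>A \<in> Obj \<C>; C \<in> Obj \<C>; A' \<in> Obj \<C>; C' \<in> Obj \<C>; U \<in> Obj \<C>;
        ext_morphism \<C> C A \<delta> C' A' \<delta>' a c; x \<in> carrier (val M A' U)\<rbrakk>
        \<Longrightarrow> e C A \<delta> U (act M a (ident \<C> U) x) = act N c (ident \<C> U) (e C' A' \<delta>' U x)"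
    and connecting_kernel:
      "\<lbrakk>s_triangle \<C> A k B p C \<delta>; U \<in> Obj \<C>; x \<in> carrier (val M A U)\<rbrakk>
        \<Longrightarrow> e C A \<delta> U x = \<one>\<^bsub>val N C U\<^esub> \<longleftrightarrow>
            (\<exists>b \<in> carrier (val M B U). x = act M k (ident \<C> U) b)"
    and connecting_image:
      "\<lbrakk>s_triangle \<C> A k B p C \<delta>; U \<in> Obj \<C>; z \<in> carrier (val N C U);
        act N p (ident \<C> U) z = \<one>\<^bsub>val N B U\<^esub>\<rbrakk>
        \<Longrightarrow> \<exists>y \<in> carrier (val M A U). z = e C A \<delta> U y"
    and target_effaceable:
      "U \<in> Obj \<C> \<Longrightarrow> weakly_effaceable_right \<C> (\<lambda>X. val N X U) (\<lambda>f. act N f (ident \<C> U))"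
begin

lemma connecting_closed:
  "\<lbrakk>A \<in> Obj \<C>; C \<in> Obj \<C>; U \<in> Obj \<C>; \<delta> \<in> carrier (val (Ext \<C>) C A); x \<in> carrier (val M A U)\<rbrakk>
    \<Longrightarrow> e C A \<delta> U x \<in> carrier (val N C U)"
  by (rule hom_in_carrier[OF connecting_hom])

lemma connecting_surjective:
  assumes "C \<in> Obj \<C>" "U \<in> Obj \<C>" "x \<in> carrier (val N C U)"
  shows "\<exists>A \<in> Obj \<C>. \<exists>\<delta> \<in> carrier (val (Ext \<C>) C A). \<exists>y \<in> carrier (val M A U). x = e C A \<delta> U y"
proof -
  obtain B p where p: "deflation \<C> B C p" and z: "act N p (ident \<C> U) x = \<one>\<^bsub>val N B U\<^esub>"
    using target_effaceable assms unfolding weakly_effaceable_right_def by blast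
  then obtain A k \<delta> where t: "s_triangle \<C> A k B p C \<delta>" by (auto simp: deflation_def)
  then show ?thesis
    using connecting_image[OF t assms(2,3) z] s_triangleD[OF t] by blast
qed

lemma connecting_push:
  assumes "C \<in> Obj \<C>" "A \<in> Obj \<C>" "A' \<in> Obj \<C>" "U \<in> Obj \<C>" "a \<in> carrier (Hom \<C> A A')"
    "\<delta> \<in> carrier (val (Ext \<C>) C A)" "y \<in> carrier (val M A' U)"
  shows "e C A' (push \<C> C a \<delta>) U y = e C A \<delta> U (act M a (ident \<C> U) y)"
  using connecting_natural[of A C A' C U \<delta> "push \<C> C a \<delta>" a "ident \<C> C" y]
    ext_morphism_push[of C A A' a \<delta>] assms
  by (simp add: target.act_ident connecting_closed push_closed)

text \<open>
  The action on the target is determined by the action on the source and by pulling back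
  extensions. Hence a map that is compatible with the connecting maps is automatically a morphism
  of bimodules.
\<close>

lemma connecting_act:
  assumes "C \<in> Obj \<C>" "C' \<in> Obj \<C>" "A \<in> Obj \<C>" "U \<in> Obj \<C>" "U' \<in> Obj \<C>"
    "\<delta> \<in> carrier (val (Ext \<C>) C A)" "c \<in> carrier (Hom \<C> C' C)" "g \<in> carrier (Hom \<C> U U')"
    "y \<in> carrier (val M A U)"
  shows "act N c g (e C A \<delta> U y) = e C' A (pull \<C> A c \<delta>) U' (act M (ident \<C> A) g y)"
proof -
  have y: "act M (ident \<C> A) g y \<in> carrier (val M A U')"
    using assms by (simp add: source.act_closed ident_in_hom)
  have "act N c g (e C A \<delta> U y) = act N c (ident \<C> U') (act N (ident \<C> C) g (e C A \<delta> U y))"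
    using assms by (simp add: target.act_split(1) connecting_closed)
  also have "\<dots> = act N c (ident \<C> U') (e C A \<delta> U' (act M (ident \<C> A) g y))"
    using assms by (simp add: connecting_module)
  also have "\<dots> = e C' A (pull \<C> A c \<delta>) U' (act M (ident \<C> A) (ident \<C> U') (act M (ident \<C> A) g y))"
    using connecting_natural[OF _ _ _ _ _ ext_morphism_pull y] assms by simp
  finally show ?thesis using y assms by (simp add: source.act_ident)
qed

lemma connecting_surjective_pair:
  assumes "C \<in> Obj \<C>" "U \<in> Obj \<C>" "x \<in> carrier (val N C U)" "x' \<in> carrier (val N C U)"
  shows "\<exists>A \<in> Obj \<C>. \<exists>\<delta> \<in> carrier (val (Ext \<C>) C A). \<exists>y \<in> carrier (val M A U).
           \<exists>y' \<in> carrier (val M A U). x = e C A \<delta> U y \<and> x' = e C A \<delta> U y'"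
proof -
  obtain A \<delta> y where 1: "A \<in> Obj \<C>" "\<delta> \<in> carrier (val (Ext \<C>) C A)"
    "y \<in> carrier (val M A U)" "x = e C A \<delta> U y"
    using connecting_surjective assms by blast
  obtain A' \<delta>' y' where 2: "A' \<in> Obj \<C>" "\<delta>' \<in> carrier (val (Ext \<C>) C A')"
    "y' \<in> carrier (val M A' U)" "x' = e C A' \<delta>' U y'"
    using connecting_surjective assms by blast
  obtain D \<xi> q q' where D: "D \<in> Obj \<C>" "\<xi> \<in> carrier (val (Ext \<C>) C D)"
    "q \<in> carrier (Hom \<C> D A)" "q' \<in> carrier (Hom \<C> D A')"
    "push \<C> C q \<xi> = \<delta>" "push \<C> C q' \<xi> = \<delta>'"
    using common_extension[OF assms(1) 1(1) 2(1) 1(2) 2(2)] by blast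
  have "x = e C D \<xi> U (act M q (ident \<C> U) y)" "x' = e C D \<xi> U (act M q' (ident \<C> U) y')"
    using connecting_push[of C D A U q \<xi> y] connecting_push[of C D A' U q' \<xi> y'] 1 2 D assms
    by simp_all
  moreover have "act M q (ident \<C> U) y \<in> carrier (val M D U)"
    "act M q' (ident \<C> U) y' \<in> carrier (val M D U)"
    using 1 2 D assms by (simp_all add: source.act_closed ident_in_hom)
  ultimately show ?thesis using D by blast
qed

end

text \<open>
  The only candidate for a continuation of \<open>t\<close> to the next degree: it sends \<open>e\<^sub>\<delta>(y)\<close> to \<open>e'\<^sub>\<delta>(t(y))\<close>.
  When \<open>t\<close> is a morphism of bimodules between the sources of two connecting maps, the value does not
  depend on the chosen representation \<open>x = e\<^sub>\<delta>(y)\<close>.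
\<close>

definition extend_hom ::
  "('o, 'm, 'e, 'z) extri_scheme \<Rightarrow> ('o, 'm, 'g) bimod \<Rightarrow>
   ('o \<Rightarrow> 'o \<Rightarrow> 'e \<Rightarrow> 'o \<Rightarrow> 'g \<Rightarrow> 'h) \<Rightarrow> ('o \<Rightarrow> 'o \<Rightarrow> 'e \<Rightarrow> 'o \<Rightarrow> 'g' \<Rightarrow> 'h') \<Rightarrow>
   ('o \<Rightarrow> 'o \<Rightarrow> 'g \<Rightarrow> 'g') \<Rightarrow> 'o \<Rightarrow> 'o \<Rightarrow> 'h \<Rightarrow> 'h'" where
  "extend_hom \<C> M e e' t C U x =
     (SOME z. \<exists>A \<in> Obj \<C>. \<exists>\<delta> \<in> carrier (val (Ext \<C>) C A). \<exists>y \<in> carrier (val M A U).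
        x = e C A \<delta> U y \<and> z = e' C A \<delta> U (t A U y))"

locale connecting_map_pair =
  first: connecting_map \<C> M N e + second: connecting_map \<C> M' N' e'
  for \<C> :: "('o, 'm, 'e, 'z) extri_scheme" (structure)
    and M :: "('o, 'm, 'g) bimod" and N :: "('o, 'm, 'h) bimod"
    and e :: "'o \<Rightarrow> 'o \<Rightarrow> 'e \<Rightarrow> 'o \<Rightarrow> 'g \<Rightarrow> 'h"
    and M' :: "('o, 'm, 'g') bimod" and N' :: "('o, 'm, 'h') bimod"
    and e' :: "'o \<Rightarrow> 'o \<Rightarrow> 'e \<Rightarrow> 'o \<Rightarrow> 'g' \<Rightarrow> 'h'"
begin

text \<open>
  The difference of \<open>y\<close> and \<open>y'\<close> lies in the kernel of \<open>e\<^sub>\<delta>\<close>, hence in the image of the inflation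
  \<open>k\<close>. The map \<open>t\<close> respects the action of \<open>k\<close>, and \<open>e'\<^sub>\<delta>\<close> kills the image of \<open>k\<close>.
\<close>

lemma extension_well_defined_same:
  assumes t: "bimodule_hom \<C> M M' t"
    and o: "C \<in> Obj \<C>" "A \<in> Obj \<C>" "U \<in> Obj \<C>" "\<delta> \<in> carrier (val (Ext \<C>) C A)"
    and y: "y \<in> carrier (val M A U)" "y' \<in> carrier (val M A U)"
    and eq: "e C A \<delta> U y = e C A \<delta> U y'"
  shows "e' C A \<delta> U (t A U y) = e' C A \<delta> U (t A U y')"
proof -
  interpret MG: comm_group "val M A U" by (rule first.source.val_group[OF o(2,3)])
  interpret NG: comm_group "val N C U" by (rule first.target.val_group[OF o(1,3)])
  interpret MG': comm_group "val M' A U" by (rule second.source.val_group[OF o(2,3)])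
  interpret NG': comm_group "val N' C U" by (rule second.target.val_group[OF o(1,3)])
  interpret eh: group_hom "val M A U" "val N C U" "e C A \<delta> U"
    by unfold_locales (rule first.connecting_hom[OF o(2,1,3,4)])
  interpret eh': group_hom "val M' A U" "val N' C U" "e' C A \<delta> U"
    by unfold_locales (rule second.connecting_hom[OF o(2,1,3,4)])
  interpret th: group_hom "val M A U" "val M' A U" "t A U"
    by unfold_locales (rule bimodule_homD(1)[OF t o(2,3)])
  obtain B k p where tr: "s_triangle \<C> A k B p C \<delta>"
    using first.realization_nonempty[OF o(2,1,4)] by blast
  note trD = first.s_triangleD[OF tr]
  define z where "z = y \<otimes>\<^bsub>val M A U\<^esub> inv\<^bsub>val M A U\<^esub> y'"
  have z: "z \<in> carrier (val M A U)" using y by (simp add: z_def)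
  have yz: "y = z \<otimes>\<^bsub>val M A U\<^esub> y'" using y by (simp add: z_def MG.m_assoc)
  have "e C A \<delta> U z = \<one>\<^bsub>val N C U\<^esub>" using y eq by (simp add: z_def)
  then obtain b where b: "b \<in> carrier (val M B U)" "z = act M k (ident \<C> U) b"
    using first.connecting_kernel[OF tr o(3) z] by blast
  have "t A U z = act M' k (ident \<C> U) (t B U b)"
    using bimodule_homD(2)[OF t] b o trD first.ident_in_hom by simp
  then have "e' C A \<delta> U (t A U z) = \<one>\<^bsub>val N' C U\<^esub>"
    using second.connecting_kernel[OF tr o(3) bimodule_hom_closed[OF t o(2,3) z]]
      bimodule_hom_closed[OF t trD(2) o(3) b(1)] by blast
  then show ?thesis using yz z y by simp
qed

lemma extension_well_defined:
  assumes t: "bimodule_hom \<C> M M' t"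
    and o: "C \<in> Obj \<C>" "U \<in> Obj \<C>"
    and 1: "A \<in> Obj \<C>" "\<delta> \<in> carrier (val (Ext \<C>) C A)" "y \<in> carrier (val M A U)"
    and 2: "A' \<in> Obj \<C>" "\<delta>' \<in> carrier (val (Ext \<C>) C A')" "y' \<in> carrier (val M A' U)"
    and eq: "e C A \<delta> U y = e C A' \<delta>' U y'"
  shows "e' C A \<delta> U (t A U y) = e' C A' \<delta>' U (t A' U y')"
proof -
  obtain D \<xi> q q' where D: "D \<in> Obj \<C>" "\<xi> \<in> carrier (val (Ext \<C>) C D)"
    "q \<in> carrier (Hom \<C> D A)" "q' \<in> carrier (Hom \<C> D A')"
    "push \<C> C q \<xi> = \<delta>" "push \<C> C q' \<xi> = \<delta>'"
    using first.common_extension[OF o(1) 1(1) 2(1) 1(2) 2(2)] by blast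
  define w where "w = act M q (ident \<C> U) y"
  define w' where "w' = act M q' (ident \<C> U) y'"
  have w: "w \<in> carrier (val M D U)" "w' \<in> carrier (val M D U)"
    using 1 2 D o by (simp_all add: w_def w'_def first.source.act_closed first.ident_in_hom)
  have ew: "e C A \<delta> U y = e C D \<xi> U w" "e C A' \<delta>' U y' = e C D \<xi> U w'"
    using first.connecting_push[of C D A U q \<xi> y] first.connecting_push[of C D A' U q' \<xi> y']
      1 2 D o by (simp_all add: w_def w'_def)
  have tw: "t D U w = act M' q (ident \<C> U) (t A U y)" "t D U w' = act M' q' (ident \<C> U) (t A' U y')"
    using bimodule_homD(2)[OF t] 1 2 D o first.ident_in_hom by (simp_all add: w_def w'_def)
  have "t A U y \<in> carrier (val M' A U)" "t A' U y' \<in> carrier (val M' A' U)"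
    using bimodule_hom_closed[OF t] 1 2 o by simp_all
  then have ew': "e' C A \<delta> U (t A U y) = e' C D \<xi> U (t D U w)"
    "e' C A' \<delta>' U (t A' U y') = e' C D \<xi> U (t D U w')"
    using second.connecting_push[of C D A U q \<xi> "t A U y"]
      second.connecting_push[of C D A' U q' \<xi> "t A' U y'"] 1 2 D o tw by simp_all
  show ?thesis
    using extension_well_defined_same[OF t o(1) D(1) o(2) D(2) w] eq ew ew' by simp
qed

lemma extend_hom_connecting:
  assumes t: "bimodule_hom \<C> M M' t"
    and "C \<in> Obj \<C>" "U \<in> Obj \<C>" "A \<in> Obj \<C>" "\<delta> \<in> carrier (val (Ext \<C>) C A)"
    "y \<in> carrier (val M A U)"
  shows "extend_hom \<C> M e e' t C U (e C A \<delta> U y) = e' C A \<delta> U (t A U y)"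
  unfolding extend_hom_def
proof (rule some_equality)
  show "\<exists>A'\<in>Obj \<C>. \<exists>\<delta>'\<in>carrier (val (Ext \<C>) C A'). \<exists>y'\<in>carrier (val M A' U).
    e C A \<delta> U y = e C A' \<delta>' U y' \<and> e' C A \<delta> U (t A U y) = e' C A' \<delta>' U (t A' U y')"
    using assms by blast
  show "z = e' C A \<delta> U (t A U y)"
    if "\<exists>A'\<in>Obj \<C>. \<exists>\<delta>'\<in>carrier (val (Ext \<C>) C A'). \<exists>y'\<in>carrier (val M A' U).
      e C A \<delta> U y = e C A' \<delta>' U y' \<and> z = e' C A' \<delta>' U (t A' U y')" for z
    using that extension_well_defined[OF t] assms by metis
qed

text \<open>
  For additivity, two elements of the target are first represented over the same extension.
\<close>

lemma extend_hom_bimodule_hom: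
  assumes t: "bimodule_hom \<C> M M' t"
  shows "bimodule_hom \<C> N N' (extend_hom \<C> M e e' t)"
proof -
  let ?s = "extend_hom \<C> M e e' t"
  note eh = extend_hom_connecting[OF t] and th = bimodule_hom_closed[OF t]
  have "?s C U \<in> hom (val N C U) (val N' C U)" if o: "C \<in> Obj \<C>" "U \<in> Obj \<C>" for C U
  proof (rule homI)
    fix x assume x: "x \<in> carrier (val N C U)"
    then show "?s C U x \<in> carrier (val N' C U)"
      using first.connecting_surjective[OF o x] o eh th second.connecting_closed by force
    fix x' assume x': "x' \<in> carrier (val N C U)"
    obtain A \<delta> y y' where A: "A \<in> Obj \<C>" "\<delta> \<in> carrier (val (Ext \<C>) C A)"
      and y: "y \<in> carrier (val M A U)" "y' \<in> carrier (val M A U)"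
      and xy: "x = e C A \<delta> U y" "x' = e C A \<delta> U y'"
      using first.connecting_surjective_pair[OF o x x'] by blast
    interpret MG: comm_group "val M A U" by (rule first.source.val_group[OF A(1) o(2)])
    have "x \<otimes>\<^bsub>val N C U\<^esub> x' = e C A \<delta> U (y \<otimes>\<^bsub>val M A U\<^esub> y')"
      using hom_mult[OF first.connecting_hom[OF A(1) o A(2)] y] xy by simp
    then have "?s C U (x \<otimes>\<^bsub>val N C U\<^esub> x') = e' C A \<delta> U (t A U (y \<otimes>\<^bsub>val M A U\<^esub> y'))"
      using eh[OF o A] y by simp
    also have "\<dots> = e' C A \<delta> U (t A U y) \<otimes>\<^bsub>val N' C U\<^esub> e' C A \<delta> U (t A U y')"
      using hom_mult[OF bimodule_homD(1)[OF t A(1) o(2)] y]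
        hom_mult[OF second.connecting_hom[OF A(1) o A(2)]] th[OF A(1) o(2)] y by simp
    finally show "?s C U (x \<otimes>\<^bsub>val N C U\<^esub> x') = ?s C U x \<otimes>\<^bsub>val N' C U\<^esub> ?s C U x'"
      using eh[OF o A] y xy by simp
  qed
  moreover have "?s C' U' (act N f g x) = act N' f g (?s C U x)"
    if o: "C \<in> Obj \<C>" "C' \<in> Obj \<C>" "U \<in> Obj \<C>" "U' \<in> Obj \<C>"
      and f: "f \<in> carrier (Hom \<C> C' C)" and g: "g \<in> carrier (Hom \<C> U U')"
      and x: "x \<in> carrier (val N C U)" for C C' U U' f g x
  proof -
    obtain A \<delta> y where A: "A \<in> Obj \<C>" "\<delta> \<in> carrier (val (Ext \<C>) C A)"
      and y: "y \<in> carrier (val M A U)" and xy: "x = e C A \<delta> U y"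
      using first.connecting_surjective[OF o(1,3) x] by blast
    have p: "pull \<C> A f \<delta> \<in> carrier (val (Ext \<C>) C' A)"
      using first.pull_closed o A f by blast
    have gy: "act M (ident \<C> A) g y \<in> carrier (val M A U')"
      using o A g y by (simp add: first.source.act_closed first.ident_in_hom)
    have "?s C' U' (act N f g x) = e' C' A (pull \<C> A f \<delta>) U' (t A U' (act M (ident \<C> A) g y))"
      using first.connecting_act[OF o(1,2) A(1) o(3,4) A(2) f g y] xy
        eh[OF o(2,4) A(1) p gy] by simp
    also have "t A U' (act M (ident \<C> A) g y) = act M' (ident \<C> A) g (t A U y)"
      using bimodule_homD(2)[OF t] o A g y first.ident_in_hom by simp
    also have "e' C' A (pull \<C> A f \<delta>) U' \<dots> = act N' f g (e' C A \<delta> U (t A U y))"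
      using second.connecting_act[OF o(1,2) A(1) o(3,4) A(2) f g] th[OF A(1) o(3) y] by simp
    finally show ?thesis using eh[OF o(1,3) A y] xy by simp
  qed
  ultimately show ?thesis unfolding bimodule_hom_def by blast
qed

text \<open>
  Surjectivity lifts a representation \<open>e'\<^sub>\<delta>(y')\<close> along \<open>t\<close>. For injectivity, if \<open>e\<^sub>\<delta>(y)\<close> goes to zero,
  then \<open>t(y)\<close> is in the image of \<open>k\<close>; as \<open>t\<close> is bijective at \<open>A\<close> and at \<open>B\<close>, the element \<open>y\<close> is also
  in the image of \<open>k\<close>, which makes \<open>e\<^sub>\<delta>(y)\<close> zero.
\<close>

lemma extend_hom_bimodule_iso:
  assumes iso: "bimodule_iso \<C> M M' t"
  shows "bimodule_iso \<C> N N' (extend_hom \<C> M e e' t)"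
proof -
  let ?s = "extend_hom \<C> M e e' t"
  have t: "bimodule_hom \<C> M M' t" using iso by (simp add: bimodule_iso_def)
  note eh = extend_hom_connecting[OF t] and th = bimodule_hom_closed[OF t]
  note sh = extend_hom_bimodule_hom[OF t]
  have "?s C U \<in> iso (val N C U) (val N' C U)" if o: "C \<in> Obj \<C>" "U \<in> Obj \<C>" for C U
  proof -
    interpret NG: comm_group "val N C U" by (rule first.target.val_group[OF o])
    interpret NG': comm_group "val N' C U" by (rule second.target.val_group[OF o])
    interpret s: group_hom "val N C U" "val N' C U" "?s C U"
      by unfold_locales (rule bimodule_homD(1)[OF sh o])
    have "x' \<in> ?s C U ` carrier (val N C U)" if x': "x' \<in> carrier (val N' C U)" for x'
    proof -
      obtain A \<delta> y' where A: "A \<in> Obj \<C>" "\<delta> \<in> carrier (val (Ext \<C>) C A)"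
        and y': "y' \<in> carrier (val M' A U)" and xy: "x' = e' C A \<delta> U y'"
        using second.connecting_surjective[OF o x'] by blast
      obtain y where y: "y \<in> carrier (val M A U)" "y' = t A U y"
        using bimodule_iso_bij[OF iso A(1) o(2)] y' by (auto simp: bij_betw_def)
      show ?thesis
        using eh[OF o A y(1)] y xy first.connecting_closed[OF A(1) o A(2) y(1)] by (metis imageI)
    qed
    moreover have "x = \<one>\<^bsub>val N C U\<^esub>"
      if x: "x \<in> carrier (val N C U)" and z: "?s C U x = \<one>\<^bsub>val N' C U\<^esub>" for x
    proof -
      obtain A \<delta> y where A: "A \<in> Obj \<C>" "\<delta> \<in> carrier (val (Ext \<C>) C A)"
        and y: "y \<in> carrier (val M A U)" and xy: "x = e C A \<delta> U y"
        using first.connecting_surjective[OF o x] by blast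
      obtain B k p where tr: "s_triangle \<C> A k B p C \<delta>"
        using first.realization_nonempty[OF A(1) o(1) A(2)] by blast
      note trD = first.s_triangleD[OF tr]
      have "e' C A \<delta> U (t A U y) = \<one>\<^bsub>val N' C U\<^esub>" using eh[OF o A y] xy z by simp
      then obtain b' where b': "b' \<in> carrier (val M' B U)"
        "t A U y = act M' k (ident \<C> U) b'"
        using second.connecting_kernel[OF tr o(2) th[OF A(1) o(2) y]] by blast
      obtain b where b: "b \<in> carrier (val M B U)" "b' = t B U b"
        using bimodule_iso_bij[OF iso trD(2) o(2)] b'(1) by (auto simp: bij_betw_def)
      have kb: "act M k (ident \<C> U) b \<in> carrier (val M A U)"
        using b o trD by (simp add: first.source.act_closed first.ident_in_hom)
      have "t A U y = t A U (act M k (ident \<C> U) b)"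
        using bimodule_homD(2)[OF t] b b' o trD first.ident_in_hom by simp
      then have "y = act M k (ident \<C> U) b"
        using bimodule_iso_bij[OF iso A(1) o(2)] y kb by (auto simp: bij_betw_def inj_on_def)
      then show ?thesis using first.connecting_kernel[OF tr o(2) y] b xy by blast
    qed
    ultimately show ?thesis unfolding s.iso_iff by blast
  qed
  then show ?thesis using sh by (simp add: bimodule_iso_def)
qed

end

section \<open>Extensions as the first derived functor of Hom\<close>

context extriangulated_category begin

lemma hom_bimodule_simps:
  "val (hom_bimodule \<C>) = Hom \<C>" "act (hom_bimodule \<C>) f g h = g \<cdot> h \<cdot> f"
  by (simp_all add: hom_bimodule_def)

lemma bimodule_hom_bimodule: "bimodule \<C> (hom_bimodule \<C>)"
proof (intro bimodule.intro bimodule_axioms.intro)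
  fix X X' A A' f g assume o: "X \<in> Obj \<C>" "X' \<in> Obj \<C>" "A \<in> Obj \<C>" "A' \<in> Obj \<C>"
    and f: "f \<in> carrier (Hom \<C> X' X)" and g: "g \<in> carrier (Hom \<C> A A')"
  show "act (hom_bimodule \<C>) f g \<in> hom (val (hom_bimodule \<C>) X A) (val (hom_bimodule \<C>) X' A')"
  proof (rule homI; unfold hom_bimodule_simps)
    fix h h' assume "h \<in> carrier (Hom \<C> X A)" "h' \<in> carrier (Hom \<C> X A)"
    then show "g \<cdot> (h \<otimes>\<^bsub>Hom \<C> X A\<^esub> h') \<cdot> f = (g \<cdot> h \<cdot> f) \<otimes>\<^bsub>Hom \<C> X' A'\<^esub> (g \<cdot> h' \<cdot> f)"
      using o f g comp_in_hom comp_add_right[of X A A' h h' g]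
        comp_add_left[of X' X A' f "g \<cdot> h" "g \<cdot> h'"] by simp
  next
    fix h assume "h \<in> carrier (Hom \<C> X A)"
    then show "g \<cdot> h \<cdot> f \<in> carrier (Hom \<C> X' A')"
      using comp_in_hom o f g by blast
  qed
next
  fix X X' X'' A A' A'' f f' g g' x
  assume o: "X \<in> Obj \<C>" "X' \<in> Obj \<C>" "X'' \<in> Obj \<C>" "A \<in> Obj \<C>" "A' \<in> Obj \<C>" "A'' \<in> Obj \<C>"
    and a: "f \<in> carrier (Hom \<C> X' X)" "f' \<in> carrier (Hom \<C> X'' X')"
      "g \<in> carrier (Hom \<C> A A')" "g' \<in> carrier (Hom \<C> A' A'')"
    and x: "x \<in> carrier (val (hom_bimodule \<C>) X A)"
  have x: "x \<in> carrier (Hom \<C> X A)" using x by (simp add: hom_bimodule_simps)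
  have gx: "g \<cdot> x \<in> carrier (Hom \<C> X A')" using comp_in_hom o a x by blast
  have gxf: "g \<cdot> x \<cdot> f \<in> carrier (Hom \<C> X' A')" using comp_in_hom o a gx by blast
  have "g' \<cdot> g \<cdot> x \<cdot> (f \<cdot> f') = g' \<cdot> (g \<cdot> x) \<cdot> (f \<cdot> f')"
    using comp_assoc[of X A A' A'' x g g'] o a x by simp
  also have "\<dots> = g' \<cdot> (g \<cdot> x \<cdot> (f \<cdot> f'))"
    using comp_assoc[of X'' X A' A'' "f \<cdot> f'" "g \<cdot> x" g'] comp_in_hom[of X'' X' X f' f] o a gx by simp
  also have "\<dots> = g' \<cdot> (g \<cdot> x \<cdot> f \<cdot> f')"
    using comp_assoc[of X'' X' X A' f' f "g \<cdot> x"] o a gx by simp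
  also have "\<dots> = g' \<cdot> (g \<cdot> x \<cdot> f) \<cdot> f'"
    using comp_assoc[of X'' X' A' A'' f' "g \<cdot> x \<cdot> f" g'] o a gxf by simp
  finally show "act (hom_bimodule \<C>) (f \<cdot> f') (g' \<cdot> g) x =
      act (hom_bimodule \<C>) f' g' (act (hom_bimodule \<C>) f g x)"
    by (simp add: hom_bimodule_simps)
qed (auto simp: preadditive_category_axioms hom_bimodule_simps hom_group comp_ident_left comp_ident_right comp_in_hom
    comp_add_left comp_add_right)

lemma ext_weakly_effaceable_right:
  assumes "U \<in> Obj \<C>"
  shows "weakly_effaceable_right \<C> (\<lambda>X. val (Ext \<C>) X U) (\<lambda>f. act (Ext \<C>) f (ident \<C> U))"
  using realization_nonempty[OF assms] pull_deflation
  unfolding weakly_effaceable_right_def deflation_def pull_def by blast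

lemma push_connecting_map: "connecting_map \<C> (hom_bimodule \<C>) (Ext \<C>) (\<lambda>C A \<delta> U f. push \<C> C f \<delta>)"
proof -
  interpret H: bimodule \<C> "hom_bimodule \<C>" by (rule bimodule_hom_bimodule)
  show ?thesis
  proof
    fix A C U \<delta> assume o: "A \<in> Obj \<C>" "C \<in> Obj \<C>" "U \<in> Obj \<C>" "\<delta> \<in> carrier (val (Ext \<C>) C A)"
    show "(\<lambda>f. push \<C> C f \<delta>) \<in> hom (val (hom_bimodule \<C>) A U) (val (Ext \<C>) C U)"
      using o by (auto intro!: homI simp: hom_bimodule_simps push_closed push_def
          Ext.act_add_right Ext.act_closed ident_in_hom)
  next
    fix A C U U' \<delta> g x
    assume "A \<in> Obj \<C>" "C \<in> Obj \<C>" "U \<in> Obj \<C>" "U' \<in> Obj \<C>" "\<delta> \<in> carrier (val (Ext \<C>) C A)"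
      "g \<in> carrier (Hom \<C> U U')" "x \<in> carrier (val (hom_bimodule \<C>) A U)"
    then show "push \<C> C (act (hom_bimodule \<C>) (ident \<C> A) g x) \<delta> =
        act (Ext \<C>) (ident \<C> C) g (push \<C> C x \<delta>)"
      using comp_in_hom[of A U U' x g] push_comp[of C A U U' x g \<delta>]
      by (simp add: hom_bimodule_simps comp_ident_right) (simp add: push_def)
  next
    fix A C A' C' U \<delta> \<delta>' a c x
    assume o: "A \<in> Obj \<C>" "C \<in> Obj \<C>" "A' \<in> Obj \<C>" "C' \<in> Obj \<C>" "U \<in> Obj \<C>"
      and m: "ext_morphism \<C> C A \<delta> C' A' \<delta>' a c" and "x \<in> carrier (val (hom_bimodule \<C>) A' U)"
    then have x: "x \<in> carrier (Hom \<C> A' U)" by (simp add: hom_bimodule_simps)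
    have m': "\<delta> \<in> carrier (val (Ext \<C>) C A)" "\<delta>' \<in> carrier (val (Ext \<C>) C' A')"
      "a \<in> carrier (Hom \<C> A A')" "c \<in> carrier (Hom \<C> C C')" "push \<C> C a \<delta> = pull \<C> A' c \<delta>'"
      using m by (auto simp: ext_morphism_def)
    have "push \<C> C (x \<cdot> a) \<delta> = push \<C> C x (pull \<C> A' c \<delta>')"
      using push_comp[of C A A' U a x \<delta>] o x m' by simp
    also have "\<dots> = act (Ext \<C>) c (ident \<C> U) (push \<C> C' x \<delta>')"
      using Ext.act_split[of C' C A' U c x \<delta>'] o x m' by (simp add: push_def pull_def)
    finally show "push \<C> C (act (hom_bimodule \<C>) a (ident \<C> U) x) \<delta> =
        act (Ext \<C>) c (ident \<C> U) (push \<C> C' x \<delta>')"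
      using o x by (simp add: hom_bimodule_simps comp_ident_left)
  next
    fix A k B p C \<delta> U x
    assume t: "s_triangle \<C> A k B p C \<delta>" and U: "U \<in> Obj \<C>"
      and "x \<in> carrier (val (hom_bimodule \<C>) A U)"
    then have x: "x \<in> carrier (Hom \<C> A U)" by (simp add: hom_bimodule_simps)
    note o = s_triangleD[OF t]
    have "push \<C> C (b \<cdot> k) \<delta> = \<one>\<^bsub>val (Ext \<C>) C U\<^esub>" if "b \<in> carrier (Hom \<C> B U)" for b
      using push_comp[of C A B U k b \<delta>] push_inflation[OF t] push_zero[of C B U b] that o U by simp
    then show "(push \<C> C x \<delta> = \<one>\<^bsub>val (Ext \<C>) C U\<^esub>) \<longleftrightarrow>
        (\<exists>b\<in>carrier (val (hom_bimodule \<C>) B U). x = act (hom_bimodule \<C>) k (ident \<C> U) b)"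
      using push_zero_factors[OF t U x] o U by (auto simp: hom_bimodule_simps comp_ident_left)
  next
    fix A k B p C \<delta> U x
    assume "s_triangle \<C> A k B p C \<delta>" "U \<in> Obj \<C>" "x \<in> carrier (val (Ext \<C>) C U)"
      "act (Ext \<C>) p (ident \<C> U) x = \<one>\<^bsub>val (Ext \<C>) B U\<^esub>"
    then show "\<exists>y\<in>carrier (val (hom_bimodule \<C>) A U). x = push \<C> C y \<delta>"
      using pull_zero_push[of A k B p C \<delta> U x] by (auto simp: pull_def hom_bimodule_simps)
  qed (simp_all add: ext_weakly_effaceable_right)
qed

end

section \<open>Comparison of delta-functors\<close>

context hom_delta_functor begin

lemma eps_connecting_map: "connecting_map \<C> (Fun T i) (Fun T (Suc i)) (eps T i)"
proof -
  interpret M: bimodule \<C> "Fun T i" by (rule Fun_bimodule)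
  interpret N: bimodule \<C> "Fun T (Suc i)" by (rule Fun_bimodule)
  have ex: "kernel (val (Fun T i) A U) (val (Fun T (Suc i)) C U) (eps T i C A \<delta> U)
        = act (Fun T i) k (ident \<C> U) ` carrier (val (Fun T i) B U)"
      "kernel (val (Fun T (Suc i)) C U) (val (Fun T (Suc i)) B U) (act (Fun T (Suc i)) p (ident \<C> U))
        = eps T i C A \<delta> U ` carrier (val (Fun T i) A U)"
    if "s_triangle \<C> A k B p C \<delta>" "U \<in> Obj \<C>" for A k B p C \<delta> U
    using eps_exact[OF that, of i] by simp_all
  show ?thesis
  proof
    show "eps T i C A \<delta> U x = \<one>\<^bsub>val (Fun T (Suc i)) C U\<^esub> \<longleftrightarrow>
        (\<exists>b\<in>carrier (val (Fun T i) B U). x = act (Fun T i) k (ident \<C> U) b)"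
      if "s_triangle \<C> A k B p C \<delta>" "U \<in> Obj \<C>" "x \<in> carrier (val (Fun T i) A U)"
      for A k B p C \<delta> U x
      using ex(1)[OF that(1,2)] that(3) by (auto simp: kernel_def set_eq_iff)
    show "\<exists>y\<in>carrier (val (Fun T i) A U). x = eps T i C A \<delta> U y"
      if "s_triangle \<C> A k B p C \<delta>" "U \<in> Obj \<C>" "x \<in> carrier (val (Fun T (Suc i)) C U)"
        "act (Fun T (Suc i)) p (ident \<C> U) x = \<one>\<^bsub>val (Fun T (Suc i)) B U\<^esub>"
      for A k B p C \<delta> U x
      using ex(2)[OF that(1,2)] that(3,4) by (auto simp: kernel_def set_eq_iff)
    show "weakly_effaceable_right \<C> (\<lambda>X. val (Fun T (Suc i)) X U)
        (\<lambda>f. act (Fun T (Suc i)) f (ident \<C> U))" if "U \<in> Obj \<C>" for U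
      using effaceable[of "Suc i"] that by (simp add: weakly_effaceable_def)
  qed (fact eps_hom eps_module eps_natural)+
qed

text \<open>
  The inverse of \<open>\<iota>\<close> extends from \<open>T\<^sup>0 \<rightarrow> Hom\<close> to an isomorphism \<open>T\<^sup>1 \<rightarrow> \<bbbE>\<close>. This is what makes the
  condition on \<open>\<eta>\<^sup>0\<close> in the definition of \<open>hom_delta_functor\<close> applicable.
\<close>

lemma ext_identification_exists: "\<exists>\<phi>. ext_identification \<C> T \<iota> \<phi>"
proof -
  interpret connecting_map_pair \<C> "Fun T 0" "Fun T (Suc 0)" "eps T 0"
    "hom_bimodule \<C>" "Ext \<C>" "\<lambda>C A \<delta> U f. push \<C> C f \<delta>"
    by (intro connecting_map_pair.intro eps_connecting_map push_connecting_map)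
  let ?\<kappa> = "bimodule_inv (hom_bimodule \<C>) \<iota>"
  have iso: "bimodule_iso \<C> (Fun T 0) (hom_bimodule \<C>) ?\<kappa>"
    by (rule bimodule_iso_inv[OF bimodule_hom_bimodule hom_zero])
  then have h: "bimodule_hom \<C> (Fun T 0) (hom_bimodule \<C>) ?\<kappa>" by (simp add: bimodule_iso_def)
  let ?\<phi> = "extend_hom \<C> (Fun T 0) (eps T 0) (\<lambda>C A \<delta> U f. push \<C> C f \<delta>) ?\<kappa>"
  have "?\<phi> C U (eps T 0 C A \<delta> U (\<iota> A U f)) = push \<C> C f \<delta>"
    if "A \<in> Obj \<C>" "C \<in> Obj \<C>" "U \<in> Obj \<C>" "\<delta> \<in> carrier (val (Ext \<C>) C A)"
      "f \<in> carrier (Hom \<C> A U)" for A C U \<delta> f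
  proof -
    have "bimodule_hom \<C> (hom_bimodule \<C>) (Fun T 0) \<iota>" using hom_zero by (simp add: bimodule_iso_def)
    then have "\<iota> A U f \<in> carrier (val (Fun T 0) A U)" "?\<kappa> A U (\<iota> A U f) = f"
      using bimodule_hom_closed[of \<C> "hom_bimodule \<C>" "Fun T 0" \<iota> A U f]
        bimodule_inv_left[OF hom_zero, of A U f] that by (simp_all add: hom_bimodule_simps)
    then show ?thesis using extend_hom_connecting[OF h that(2,3,1,4)] by simp
  qed
  then have "ext_identification \<C> T \<iota> ?\<phi>"
    using extend_hom_bimodule_iso[OF iso] by (simp add: ext_identification_def)
  then show ?thesis by blast
qed

text \<open>
  Both sides become \<open>f\<^sup>*\<psi>\<close> in \<open>\<bbbE>(U, F)\<close>. The equation expresses \<open>\<eta>\<^sup>0\<close> through \<open>\<epsilon>\<^sup>0\<close> alone.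
\<close>

lemma eta_zero_eq_eps_zero:
  assumes o: "U \<in> Obj \<C>" "H \<in> Obj \<C>" "F \<in> Obj \<C>" and d: "\<psi> \<in> carrier (val (Ext \<C>) H F)"
    and f: "f \<in> carrier (Hom \<C> U H)"
  shows "eta T 0 H F \<psi> U (\<iota> U H f) = eps T 0 U F (pull \<C> F f \<psi>) F (\<iota> F F (ident \<C> F))"
proof -
  obtain \<phi> where p: "ext_identification \<C> T \<iota> \<phi>" using ext_identification_exists by blast
  then have iso: "bimodule_iso \<C> (Fun T (Suc 0)) (Ext \<C>) \<phi>"
    by (simp add: ext_identification_def)
  have h: "bimodule_hom \<C> (hom_bimodule \<C>) (Fun T 0) \<iota>" using hom_zero by (simp add: bimodule_iso_def)
  have pl: "pull \<C> F f \<psi> \<in> carrier (val (Ext \<C>) U F)" using pull_closed o d f by blast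
  have \<iota>: "\<iota> U H f \<in> carrier (val (Fun T 0) U H)" "\<iota> F F (ident \<C> F) \<in> carrier (val (Fun T 0) F F)"
    using bimodule_hom_closed[OF h] o f by (simp_all add: hom_bimodule_simps ident_in_hom)
  have "\<phi> U F (eta T 0 H F \<psi> U (\<iota> U H f)) = pull \<C> F f \<psi>"
    using eta_zero[OF p] o d f by simp
  also have "\<dots> = \<phi> U F (eps T 0 U F (pull \<C> F f \<psi>) F (\<iota> F F (ident \<C> F)))"
    using p o pl push_ident[OF o(1,3) pl] by (simp add: ext_identification_def ident_in_hom)
  finally show ?thesis
    using bimodule_iso_bij[OF iso o(1,3)] hom_in_carrier[OF eta_hom[OF o(3,2,1) d] \<iota>(1)]
      hom_in_carrier[OF eps_hom[OF o(3,1,3) pl] \<iota>(2)]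
    by (simp add: bij_betw_def inj_on_def)
qed

end

locale hom_delta_functor_pair = R: hom_delta_functor \<C> R \<iota>R + T: hom_delta_functor \<C> T \<iota>T
  for \<C> :: "('o, 'm, 'e, 'z) extri_scheme" (structure)
    and R :: "('o, 'm, 'e, 'g) delta_data" and \<iota>R :: "'o \<Rightarrow> 'o \<Rightarrow> 'm \<Rightarrow> 'g"
    and T :: "('o, 'm, 'e, 'h) delta_data" and \<iota>T :: "'o \<Rightarrow> 'o \<Rightarrow> 'm \<Rightarrow> 'h"
begin

primrec comparison :: "nat \<Rightarrow> 'o \<Rightarrow> 'o \<Rightarrow> 'g \<Rightarrow> 'h" where
  "comparison 0 = (\<lambda>X A x. \<iota>T X A (bimodule_inv (hom_bimodule \<C>) \<iota>R X A x))"
| "comparison (Suc i) = extend_hom \<C> (Fun R i) (eps R i) (eps T i) (comparison i)"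

lemma eps_connecting_map_pair:
  "connecting_map_pair \<C> (Fun R i) (Fun R (Suc i)) (eps R i) (Fun T i) (Fun T (Suc i)) (eps T i)"
  by (intro connecting_map_pair.intro R.eps_connecting_map T.eps_connecting_map)

lemma comparison_iso: "bimodule_iso \<C> (Fun R i) (Fun T i) (comparison i)"
proof (induction i)
  case 0
  show ?case
    using bimodule_iso_comp[OF bimodule_iso_inv[OF R.bimodule_hom_bimodule R.hom_zero] T.hom_zero]
    by simp
next
  case (Suc i)
  then show ?case using connecting_map_pair.extend_hom_bimodule_iso[OF eps_connecting_map_pair] by simp
qed

lemma comparison_hom: "bimodule_hom \<C> (Fun R i) (Fun T i) (comparison i)"
  using comparison_iso by (simp add: bimodule_iso_def)

lemma comparison_zero:
  "\<lbrakk>X \<in> Obj \<C>; A \<in> Obj \<C>; f \<in> carrier (Hom \<C> X A)\<rbrakk> \<Longrightarrow> comparison 0 X A (\<iota>R X A f) = \<iota>T X A f"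
  using bimodule_inv_left[OF R.hom_zero, of X A f] by (simp add: R.hom_bimodule_simps)

lemma comparison_eps:
  "\<lbrakk>A \<in> Obj \<C>; C \<in> Obj \<C>; U \<in> Obj \<C>; \<delta> \<in> carrier (val (Ext \<C>) C A); x \<in> carrier (val (Fun R i) A U)\<rbrakk>
    \<Longrightarrow> comparison (Suc i) C U (eps R i C A \<delta> U x) = eps T i C A \<delta> U (comparison i A U x)"
  using connecting_map_pair.extend_hom_connecting[OF eps_connecting_map_pair comparison_hom] by simp

text \<open>
  Induction on the degree. The step represents \<open>x\<close> as \<open>\<epsilon>\<^sub>\<delta>(y)\<close> and uses that \<open>\<eta>\<close> and \<open>\<epsilon>\<close> commute,
  in \<open>R\<close> and in \<open>T\<close>, so that the induction hypothesis applies to \<open>y\<close>.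
\<close>

lemma comparison_eta:
  assumes F: "F \<in> Obj \<C>" and H: "H \<in> Obj \<C>" and U: "U \<in> Obj \<C>"
    and d: "\<psi> \<in> carrier (val (Ext \<C>) H F)" and x: "x \<in> carrier (val (Fun R i) U H)"
  shows "comparison (Suc i) U F (eta R i H F \<psi> U x) = eta T i H F \<psi> U (comparison i U H x)"
  using U x
proof (induction i arbitrary: U x)
  case 0
  obtain f where f: "f \<in> carrier (Hom \<C> U H)" "x = \<iota>R U H f"
    using bimodule_iso_bij[OF R.hom_zero 0(1) H] 0(2) by (auto simp: bij_betw_def R.hom_bimodule_simps)
  have "bimodule_hom \<C> (hom_bimodule \<C>) (Fun R 0) \<iota>R"
    using R.hom_zero by (simp add: bimodule_iso_def)
  then have id: "\<iota>R F F (ident \<C> F) \<in> carrier (val (Fun R 0) F F)"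
    using bimodule_hom_closed[of \<C> "hom_bimodule \<C>" "Fun R 0" \<iota>R F F "ident \<C> F"] F
    by (simp add: R.hom_bimodule_simps R.ident_in_hom)
  have "comparison (Suc 0) U F (eta R 0 H F \<psi> U x)
      = comparison (Suc 0) U F (eps R 0 U F (pull \<C> F f \<psi>) F (\<iota>R F F (ident \<C> F)))"
    using R.eta_zero_eq_eps_zero[OF 0(1) H F d f(1)] f(2) by simp
  also have "\<dots> = eps T 0 U F (pull \<C> F f \<psi>) F (comparison 0 F F (\<iota>R F F (ident \<C> F)))"
    using comparison_eps[OF F 0(1) F R.pull_closed[OF H 0(1) F f(1) d] id] .
  also have "\<dots> = eta T 0 H F \<psi> U (comparison 0 U H x)"
    using T.eta_zero_eq_eps_zero[OF 0(1) H F d f(1)] f comparison_zero 0(1) F H R.ident_in_hom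
    by (simp del: comparison.simps)
  finally show ?case .
next
  case (Suc i)
  interpret c: connecting_map \<C> "Fun R i" "Fun R (Suc i)" "eps R i" by (rule R.eps_connecting_map)
  obtain A \<delta> y where A: "A \<in> Obj \<C>" "\<delta> \<in> carrier (val (Ext \<C>) U A)"
    and y: "y \<in> carrier (val (Fun R i) A H)" and xy: "x = eps R i U A \<delta> H y"
    using c.connecting_surjective[OF Suc(2) H Suc(3)] by blast
  obtain B k p where t: "s_triangle \<C> A k B p U \<delta>"
    using R.realization_nonempty[OF A(1) Suc(2) A(2)] by blast
  obtain G l q where t': "s_triangle \<C> F l G q H \<psi>"
    using R.realization_nonempty[OF F H d] by blast
  have ey: "eta R i H F \<psi> A y \<in> carrier (val (Fun R (Suc i)) A F)"
    using hom_in_carrier[OF R.eta_hom[OF F H A(1) d] y] .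
  have ty: "comparison i A H y \<in> carrier (val (Fun T i) A H)"
    using bimodule_hom_closed[OF comparison_hom A(1) H y] .
  have "comparison (Suc (Suc i)) U F (eta R (Suc i) H F \<psi> U x)
      = comparison (Suc (Suc i)) U F (eps R (Suc i) U A \<delta> F (eta R i H F \<psi> A y))"
    using R.eta_eps_commute[of "Suc (Suc i)", OF _ t t'] y xy by simp
  also have "\<dots> = eps T (Suc i) U A \<delta> F (comparison (Suc i) A F (eta R i H F \<psi> A y))"
    by (rule comparison_eps[OF A(1) Suc(2) F A(2) ey])
  also have "\<dots> = eps T (Suc i) U A \<delta> F (eta T i H F \<psi> A (comparison i A H y))"
    using Suc.IH[OF A(1) y] by simp
  also have "\<dots> = eta T (Suc i) H F \<psi> U (eps T i U A \<delta> H (comparison i A H y))"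
    using T.eta_eps_commute[of "Suc (Suc i)", OF _ t t'] ty by simp
  also have "eps T i U A \<delta> H (comparison i A H y) = comparison (Suc i) U H x"
    using comparison_eps[OF A(1) Suc(2) H A(2) y] xy by simp
  finally show ?case .
qed

lemma comparison_delta_isomorphism: "delta_isomorphism \<C> R T comparison"
  using comparison_iso comparison_hom comparison_eps comparison_eta
  by (simp add: delta_isomorphism_def delta_morphism_def del: comparison.simps)

lemma delta_morphism_unique:
  assumes m: "delta_morphism \<C> R T \<theta>"
    and m': "delta_morphism \<C> R T \<theta>'"
    and z: "\<And>X A f. \<lbrakk>X \<in> Obj \<C>; A \<in> Obj \<C>; f \<in> carrier (Hom \<C> X A)\<rbrakk>
              \<Longrightarrow> \<theta> 0 X A (\<iota>R X A f) = \<theta>' 0 X A (\<iota>R X A f)"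
    and "X \<in> Obj \<C>" "A \<in> Obj \<C>" "x \<in> carrier (val (Fun R i) X A)"
  shows "\<theta> i X A x = \<theta>' i X A x"
  using assms(4-6)
proof (induction i arbitrary: X A x)
  case 0
  then obtain f where "f \<in> carrier (Hom \<C> X A)" "x = \<iota>R X A f"
    using bimodule_iso_bij[OF R.hom_zero 0(1,2)] by (auto simp: bij_betw_def R.hom_bimodule_simps)
  then show ?case using z 0 by simp
next
  case (Suc i)
  interpret c: connecting_map \<C> "Fun R i" "Fun R (Suc i)" "eps R i" by (rule R.eps_connecting_map)
  obtain D \<delta> y where "D \<in> Obj \<C>" "\<delta> \<in> carrier (val (Ext \<C>) X D)"
    "y \<in> carrier (val (Fun R i) D A)" "x = eps R i X D \<delta> A y"
    using c.connecting_surjective[OF Suc(2-4)] by blast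
  then show ?case using m m' Suc unfolding delta_morphism_def by metis
qed

end

theorem corollary2p6:
  fixes \<C> :: "('o, 'm, 'e) extri"
    and T :: "('o, 'm, 'e, 'g) delta_data" and \<iota>T :: "'o \<Rightarrow> 'o \<Rightarrow> 'm \<Rightarrow> 'g"
    and R :: "('o, 'm, 'e, 'h) delta_data" and \<iota>R :: "'o \<Rightarrow> 'o \<Rightarrow> 'm \<Rightarrow> 'h"
  assumes "extriangulated_category \<C>"
    and "hom_delta_functor \<C> T \<iota>T"
    and "hom_delta_functor \<C> R \<iota>R"
  shows "\<exists>\<theta>. (delta_isomorphism \<C> R T \<theta> \<and>
              (\<forall>X \<in> Obj \<C>. \<forall>A \<in> Obj \<C>. \<forall>f \<in> carrier (Hom \<C> X A). \<theta> 0 X A (\<iota>R X A f) = \<iota>T X A f)) \<and>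
             (\<forall>\<theta>'. delta_isomorphism \<C> R T \<theta>' \<and>
                    (\<forall>X \<in> Obj \<C>. \<forall>A \<in> Obj \<C>. \<forall>f \<in> carrier (Hom \<C> X A).
                       \<theta>' 0 X A (\<iota>R X A f) = \<iota>T X A f) \<longrightarrow>
                    (\<forall>i. \<forall>X \<in> Obj \<C>. \<forall>A \<in> Obj \<C>. \<forall>x \<in> carrier (val (Fun R i) X A).
                       \<theta>' i X A x = \<theta> i X A x))"
proof -
  interpret hom_delta_functor_pair \<C> R \<iota>R T \<iota>T
    by (intro hom_delta_functor_pair.intro assms)
  show ?thesis
  proof (intro exI[of _ comparison] conjI ballI allI impI)
    show "delta_isomorphism \<C> R T comparison" by (rule comparison_delta_isomorphism)
    show "comparison 0 X A (\<iota>R X A f) = \<iota>T X A f"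
      if "X \<in> Obj \<C>" "A \<in> Obj \<C>" "f \<in> carrier (Hom \<C> X A)" for X A f
      by (rule comparison_zero[OF that])
    show "\<theta>' i X A x = comparison i X A x"
      if \<theta>': "delta_isomorphism \<C> R T \<theta>' \<and> (\<forall>X\<in>Obj \<C>. \<forall>A\<in>Obj \<C>. \<forall>f\<in>carrier (Hom \<C> X A).
          \<theta>' 0 X A (\<iota>R X A f) = \<iota>T X A f)"
        and "X \<in> Obj \<C>" "A \<in> Obj \<C>" "x \<in> carrier (val (Fun R i) X A)" for \<theta>' i X A x
      by (rule delta_morphism_unique[OF _ _ _ that(2-4)])
        (use \<theta>' comparison_delta_isomorphism comparison_zero in
          \<open>simp_all add: delta_isomorphism_def del: comparison.simps\<close>)
  qed
qed

end
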